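(* Let $W_n=C_n+v$ denote the wheel on $n+1\ge 4$ vertices (a cycle $C_n$ together with a centre vertex $v$ adjacent to all vertices of $C_n$). (a) $crx_1(W_n)=3$ for $n\ge 3$. (b) $crx_2(W_3)=3$, and $crx_2(W_n)=\lceil n/2\rceil+2$ for $n\ge 4$. (c) $crx_3(W_n)=n$ if $3\le n\le 7$; $crx_3(W_n)=n-1$ if $8\le n\le 11$; and $crx_3(W_n)=n-2$ if $n\ge 12$. (d) For $k\ge 4$ and $n+1\ge k$: $crx_k(W_n)=n+1$ if $n<2k$, and $crx_k(W_n)=n$ if $n\ge 2k$.
   Context: An edge-coloured cycle is rainbow if its edges have distinct colours. For a graph $G$ in which any $k$ vertices lie on a common cycle, $crx_k(G)$ is the minimum number of colours in an edge-colouring of $G$ such that every set of $k$ vertices of $G$ lies in some rainbow cycle. *)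

theory Defs
  imports Complex_Main
begin

definition cycle_edges :: "'a list \<Rightarrow> 'a set set" where
  "cycle_edges xs = {{xs ! i, xs ! (Suc i mod length xs)} | i. i < length xs}"

definition is_cycle :: "'a set \<Rightarrow> 'a set set \<Rightarrow> 'a list \<Rightarrow> bool" where
  "is_cycle V E xs \<longleftrightarrow> length xs \<ge> 3 \<and> distinct xs \<and> set xs \<subseteq> V \<and> cycle_edges xs \<subseteq> E"

definition rainbow_cycle :: "'a set \<Rightarrow> 'a set set \<Rightarrow> ('a set \<Rightarrow> nat) \<Rightarrow> 'a list \<Rightarrow> bool" where
  "rainbow_cycle V E c xs \<longleftrightarrow> is_cycle V E xs \<and> inj_on c (cycle_edges xs)"

definition k_rainbow_cycle_colouring ::
  "'a set \<Rightarrow> 'a set set \<Rightarrow> nat \<Rightarrow> ('a set \<Rightarrow> nat) \<Rightarrow> bool" where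
  "k_rainbow_cycle_colouring V E k c \<longleftrightarrow>
     (\<forall>S. S \<subseteq> V \<and> card S = k \<longrightarrow> (\<exists>xs. rainbow_cycle V E c xs \<and> S \<subseteq> set xs))"

definition crx :: "'a set \<Rightarrow> 'a set set \<Rightarrow> nat \<Rightarrow> nat" where
  "crx V E k = (LEAST m. \<exists>c :: 'a set \<Rightarrow> nat. k_rainbow_cycle_colouring V E k c \<and> card (c ` E) = m)"

definition wheel_V :: "nat \<Rightarrow> nat set" where
  "wheel_V n = {0..n}"

definition wheel_E :: "nat \<Rightarrow> nat set set" where
  "wheel_E n = {{i, Suc i mod n} | i. i < n} \<union> {{i, n} | i. i < n}"

end

theory Submission
  imports Defs
begin

text \<open>A cycle of the wheel is the rim or consists of two spokes and an arc of the rim, that is, it omits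
  a window of consecutive rim edges. A set of vertices is served by such a hub cycle iff no vertex of the
  set lies strictly inside the window, and a rainbow hub cycle omitting \<open>g\<close> rim edges needs \<open>n - g + 2\<close>
  colours.

  For \<open>k = 2\<close> the rim is coloured with period \<open>(n + 1) div 2\<close>, and two more colours separate the end spokes
  of arcs of half length. For \<open>k \<ge> 3\<close> the colourings with at most \<open>n\<close> colours come from windows with pairwise
  disjoint interiors, more of them than there are rim vertices to be served. For the lower bound with \<open>k = 3\<close>, three vertices cut the rim into three parts, one
  of which must contain an edge of every repeated pair of rim colours. So at most two colours repeat, and
  if two do, then their edges alternate, cutting the rim into four windows that must all be long. For
  \<open>k \<ge> 4\<close> the rim must be rainbow unless \<open>n + 1\<close> colours are used, and with \<open>n\<close> colours there are so few
  minimal windows with rainbow complement that \<open>k - 1\<close> vertices spoil them all once \<open>n < 2 k\<close>.\<close>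

section \<open>Cycles of the wheel\<close>

definition rim_colour :: "(nat set \<Rightarrow> nat) \<Rightarrow> nat \<Rightarrow> nat \<Rightarrow> nat" where
  "rim_colour c n i = c {i mod n, Suc i mod n}"

definition spoke_colour :: "(nat set \<Rightarrow> nat) \<Rightarrow> nat \<Rightarrow> nat \<Rightarrow> nat" where
  "spoke_colour c n i = c {i mod n, n}"

text \<open>For colourings \<open>r\<close> of the rim edges \<open>{i, i + 1}\<close> and \<open>s\<close> of the spokes, both \<open>n\<close>-periodic,
  \<open>gap n r s l g\<close> says that the hub cycle omitting the \<open>g\<close> rim edges between \<open>l\<close> and \<open>l + g\<close> is rainbow.
  It misses exactly the rim vertices strictly between \<open>l\<close> and \<open>l + g\<close>.\<close>

definition gap :: "nat \<Rightarrow> (nat \<Rightarrow> nat) \<Rightarrow> (nat \<Rightarrow> nat) \<Rightarrow> nat \<Rightarrow> nat \<Rightarrow> bool" where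
  "gap n r s l g \<longleftrightarrow> 1 \<le> g \<and> g < n \<and> inj_on r {l+g..<l+n} \<and> s l \<noteq> s (l+g)
     \<and> s l \<notin> r ` {l+g..<l+n} \<and> s (l+g) \<notin> r ` {l+g..<l+n}"

text \<open>\<open>x\<close> runs over all representatives because windows may pass
  \<open>n\<close>. The hub \<open>n\<close> is never a residue modulo \<open>n\<close>, so a hub in
  \<open>S\<close> costs nothing, as it should for a hub cycle.\<close>

definition avoids :: "nat \<Rightarrow> nat set \<Rightarrow> nat \<Rightarrow> nat \<Rightarrow> bool" where
  "avoids n S l g \<longleftrightarrow> (\<forall>x. x mod n \<in> S \<longrightarrow> \<not> (l < x \<and> x < l + g))"

text \<open>The rim misses just the hub; every other cycle of the wheel is a hub cycle.\<close>

definition covered :: "nat \<Rightarrow> (nat \<Rightarrow> nat) \<Rightarrow> (nat \<Rightarrow> nat) \<Rightarrow> nat set \<Rightarrow> bool" where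
  "covered n r s S \<longleftrightarrow> (inj_on r {..<n} \<and> n \<notin> S) \<or> (\<exists>l g. gap n r s l g \<and> avoids n S l g)"

section \<open>Edge sets of cycles up to rotation and reversal\<close>

lemma cycle_edges_Cons:
  assumes "ys \<noteq> []"
  shows "cycle_edges (x # ys) =
    insert {x, hd ys} (insert {x, last ys} {{ys ! j, ys ! Suc j} | j. Suc j < length ys})"
proof -
  let ?m = "length ys"
  have split: "{..<Suc ?m} = insert 0 (insert ?m (Suc ` {j. Suc j < ?m}))"
  proof (rule set_eqI)
    fix i show "i \<in> {..<Suc ?m} \<longleftrightarrow> i \<in> insert 0 (insert ?m (Suc ` {j. Suc j < ?m}))"
      by (cases i) auto
  qed
  have "cycle_edges (x # ys) = (\<lambda>i. {(x # ys) ! i, (x # ys) ! (Suc i mod Suc ?m)}) ` {..<Suc ?m}"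
    by (auto simp: cycle_edges_def)
  also have "\<dots> = insert {x, hd ys} (insert {x, last ys} {{ys ! j, ys ! Suc j} | j. Suc j < ?m})"
  proof -
    have 0: "(x # ys) ! (Suc 0 mod Suc ?m) = hd ys"
      using assms by (cases ys) auto
    have m: "(x # ys) ! ?m = last ys"
      using assms by (simp add: nth_Cons' last_conv_nth)
    have "(\<lambda>i. {(x # ys) ! i, (x # ys) ! (Suc i mod Suc ?m)}) ` Suc ` {j. Suc j < ?m}
      = (\<lambda>j. {ys ! j, ys ! Suc j}) ` {j. Suc j < ?m}"
      unfolding image_image by (rule image_cong) auto
    also have "\<dots> = {{ys ! j, ys ! Suc j} | j. Suc j < ?m}"
      by (simp add: image_Collect)
    finally show ?thesis
      unfolding split image_insert using 0 m by (simp add: insert_commute)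
  qed
  finally show ?thesis .
qed

lemma cycle_edges_image:
  "cycle_edges xs = (\<lambda>i. {xs ! i, xs ! (Suc i mod length xs)}) ` {..<length xs}"
  unfolding cycle_edges_def lessThan_def by (rule setcompr_eq_image)

lemma edge_in_cycle_edges:
  assumes "i < length xs"
  shows "{xs ! i, xs ! (Suc i mod length xs)} \<in> cycle_edges xs"
  unfolding cycle_edges_image using assms by simp

text \<open>With the index running over all naturals, a rotation becomes a mere shift of the
  index.\<close>

lemma cycle_edges_range:
  assumes "xs \<noteq> []"
  shows "cycle_edges xs = range (\<lambda>i. {xs ! (i mod length xs), xs ! (Suc i mod length xs)})"
proof -
  have "{xs ! (i mod length xs), xs ! (Suc i mod length xs)} \<in> cycle_edges xs" for i
    unfolding cycle_edges_def using assms
    by (auto intro!: exI[of _ "i mod length xs"] simp: mod_Suc_eq)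
  moreover have "e \<in> range (\<lambda>i. {xs ! (i mod length xs), xs ! (Suc i mod length xs)})"
    if e: "e \<in> cycle_edges xs" for e
  proof -
    obtain i where "i < length xs" "e = {xs ! i, xs ! (Suc i mod length xs)}"
      using e by (auto simp: cycle_edges_def)
    then show ?thesis by (intro range_eqI[of _ _ i]) simp
  qed
  ultimately show ?thesis by blast
qed

lemma cycle_edges_rotate: "cycle_edges (rotate k xs) = cycle_edges xs"
proof (cases "xs = []")
  case False
  let ?m = "length xs"
  let ?e = "\<lambda>i. {xs ! (i mod ?m), xs ! (Suc i mod ?m)}"
  have m: "?m > 0" using False by simp
  have "cycle_edges (rotate k xs) = range (\<lambda>i. ?e (k + i))"
    using False by (simp add: cycle_edges_range nth_rotate mod_add_right_eq)
  also have "\<dots> = range ?e"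
  proof
    show "range ?e \<subseteq> range (\<lambda>i. ?e (k + i))"
    proof clarify
      fix i
      \<comment> \<open>The shift by \<open>k\<close> is completed by \<open>?m - 1\<close> further
        shifts by \<open>k\<close> to \<open>k\<close> full rounds.\<close>
      have eq: "k + (i + (?m - 1) * k) = i + ?m * k"
        using m by (cases ?m) auto
      have "?e i = ?e (i + ?m * k)"
        by (simp flip: add_Suc)
      then have "?e i = ?e (k + (i + (?m - 1) * k))"
        by (simp only: eq)
      then show "?e i \<in> range (\<lambda>i. ?e (k + i))" by blast
    qed
  qed auto
  finally show ?thesis using False by (simp add: cycle_edges_range)
qed simp

lemma cycle_edges_rev: "cycle_edges (rev xs) = cycle_edges xs"
proof -
  have sub: "cycle_edges (rev ys) \<subseteq> cycle_edges ys" for ys :: "'a list"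
  proof
    fix e assume "e \<in> cycle_edges (rev ys)"
    then obtain i where i: "i < length ys"
      and e: "e = {rev ys ! i, rev ys ! (Suc i mod length ys)}"
      by (auto simp: cycle_edges_def)
    show "e \<in> cycle_edges ys"
    proof (cases "Suc i = length ys")
      case True
      then have "e = {ys ! i, ys ! (Suc i mod length ys)}"
        using i e by (auto simp: rev_nth insert_commute simp flip: True)
      then show ?thesis using i by (auto simp: cycle_edges_def)
    next
      case False
      define j where "j = length ys - Suc (Suc i)"
      have j: "Suc j < length ys" "length ys - Suc i = Suc j" "length ys - Suc (Suc i) = j"
        using i False by (auto simp: j_def)
      then have "e = {ys ! j, ys ! (Suc j mod length ys)}"
        using i False e by (auto simp: rev_nth)
      then show ?thesis using j by (auto simp: cycle_edges_def)
    qed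
  qed
  from sub[of xs] sub[of "rev xs"] show ?thesis by simp
qed

lemma rainbow_cycle_rotate: "rainbow_cycle V E c (rotate k xs) \<longleftrightarrow> rainbow_cycle V E c xs"
  by (simp add: rainbow_cycle_def is_cycle_def cycle_edges_rotate)

lemma rainbow_cycle_rev: "rainbow_cycle V E c (rev xs) \<longleftrightarrow> rainbow_cycle V E c xs"
  by (simp add: rainbow_cycle_def is_cycle_def cycle_edges_rev)

section \<open>Residues, edges of the wheel and paths on the rim\<close>

lemma Suc_mod_inj:
  assumes "x < n" "y < n" "Suc x mod n = Suc y mod n"
  shows "x = y"
  using assms by (auto simp: mod_Suc split: if_splits)

lemma ex_mod_in_period:
  fixes x a n :: nat
  assumes "x < n"
  obtains y where "a \<le> y" "y < a + n" "y mod n = x"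
proof -
  define b where "b = (if x < a mod n then x + n else x)"
  define y where "y = a div n * n + b"
  have a: "a = a div n * n + a mod n" by simp
  have "a mod n < n" using assms by simp
  then have "a \<le> y" "y < a + n" using assms a unfolding y_def b_def by (auto split: if_splits; linarith)+
  moreover have "y mod n = x" using assms by (simp add: y_def b_def)
  ultimately show ?thesis using that by blast
qed

lemma mod_inj_on_period:
  fixes x y a n :: nat
  assumes "x mod n = y mod n" "a \<le> x" "x < a + n" "a \<le> y" "y < a + n"
  shows "x = y"
proof (rule ccontr)
  assume ne: "x \<noteq> y"
  have "n dvd (if x < y then y - x else x - y)"
    using assms(1) by (auto simp: mod_eq_dvd_iff_nat) (metis assms(1) less_imp_le mod_eq_dvd_iff_nat)
  then have "n \<le> (if x < y then y - x else x - y)"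
    using ne by (auto dest!: dvd_imp_le)
  then show False using assms by (auto split: if_splits)
qed

lemma wheel_E_image:
  "wheel_E n = (\<lambda>i. {i mod n, Suc i mod n}) ` {..<n} \<union> (\<lambda>i. {i mod n, n}) ` {..<n}"
proof -
  have "(\<lambda>i. {i mod n, Suc i mod n}) ` {..<n} = (\<lambda>i. {i, Suc i mod n}) ` {..<n}"
    "(\<lambda>i. {i mod n, n}) ` {..<n} = (\<lambda>i. {i, n}) ` {..<n}"
    by (rule image_cong; simp)+
  moreover have "{{i, Suc i mod n} | i. i < n} = (\<lambda>i. {i, Suc i mod n}) ` {..<n}"
    "{{i, n} | i. i < n} = (\<lambda>i. {i, n}) ` {..<n}"
    unfolding lessThan_def by (rule setcompr_eq_image)+
  ultimately show ?thesis by (simp only: wheel_E_def)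
qed

lemma rim_edge_in_wheel_E:
  assumes "n > 0"
  shows "{i mod n, Suc i mod n} \<in> wheel_E n"
proof -
  have "{(i mod n) mod n, Suc (i mod n) mod n} \<in> wheel_E n"
    unfolding wheel_E_image using assms by (intro UnI1 imageI) simp
  then show ?thesis by (simp add: mod_Suc_eq)
qed

lemma spoke_in_wheel_E:
  assumes "n > 0"
  shows "{n, i mod n} \<in> wheel_E n"
proof -
  have "{(i mod n) mod n, n} \<in> wheel_E n"
    unfolding wheel_E_image using assms by (intro UnI2 imageI) simp
  then show ?thesis by (simp add: insert_commute)
qed

lemma rim_edge_iff:
  assumes "x < n" "y < n"
  shows "{x, y} \<in> wheel_E n \<longleftrightarrow> y = Suc x mod n \<or> x = Suc y mod n"
proof
  assume "{x, y} \<in> wheel_E n"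
  then obtain i where "i < n" "{x, y} = {i mod n, Suc i mod n} \<or> {x, y} = {i mod n, n}"
    unfolding wheel_E_image by blast
  then show "y = Suc x mod n \<or> x = Suc y mod n"
    using assms by (auto simp: doubleton_eq_iff)
next
  assume "y = Suc x mod n \<or> x = Suc y mod n"
  then show "{x, y} \<in> wheel_E n"
    using assms rim_edge_in_wheel_E[of n x] rim_edge_in_wheel_E[of n y]
    by (auto simp: insert_commute)
qed

text \<open>A path on the rim cannot turn, since turning would revisit the vertex of two steps
  before. So it keeps one direction, which a reversal makes increasing.\<close>

lemma rim_path_monotone:
  assumes "distinct ys" "set ys \<subseteq> {..<n}"
    and adj: "\<And>j. Suc j < length ys \<Longrightarrow> {ys ! j, ys ! Suc j} \<in> wheel_E n"
  obtains zs a where "zs = ys \<or> zs = rev ys" "zs = map (\<lambda>j. j mod n) [a..<a + length ys]"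
proof -
  have lt: "ys ! j < n" if "j < length ys" for j
    using assms(2) nth_mem[OF that] by blast
  define up where "up j \<longleftrightarrow> ys ! Suc j = Suc (ys ! j) mod n" for j
  define down where "down j \<longleftrightarrow> ys ! j = Suc (ys ! Suc j) mod n" for j
  have ud: "up j \<or> down j" if "Suc j < length ys" for j
    using adj[OF that] rim_edge_iff[of "ys ! j" n "ys ! Suc j"] lt that
    by (simp add: up_def down_def)
  have neq: "ys ! j \<noteq> ys ! Suc (Suc j)" if "Suc (Suc j) < length ys" for j
    using that assms(1) by (simp add: nth_eq_iff_index_eq)
  have not1: "\<not> (up j \<and> down (Suc j))" if "Suc (Suc j) < length ys" for j
    using neq[OF that] that Suc_mod_inj[of "ys ! j" n "ys ! Suc (Suc j)"] lt
    by (auto simp: up_def down_def)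
  have not2: "\<not> (down j \<and> up (Suc j))" if "Suc (Suc j) < length ys" for j
    using neq[OF that] by (auto simp: up_def down_def)
  have map_up: "zs = map (\<lambda>j. j mod n) [zs ! 0..<zs ! 0 + length zs]"
    if "\<And>j. Suc j < length zs \<Longrightarrow> zs ! Suc j = Suc (zs ! j) mod n" "set zs \<subseteq> {..<n}" for zs
  proof -
    have "zs ! j = (zs ! 0 + j) mod n" if "j < length zs" for j
      using that
    proof (induction j)
      case 0
      then show ?case using \<open>set zs \<subseteq> {..<n}\<close> by (auto simp: subset_iff)
    next
      case (Suc j)
      then show ?case using \<open>\<And>j. Suc j < length zs \<Longrightarrow> zs ! Suc j = Suc (zs ! j) mod n\<close>[of j]
        by (simp add: mod_Suc_eq)
    qed
    then show ?thesis by (auto intro!: nth_equalityI)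
  qed
  consider (up) "\<And>j. Suc j < length ys \<Longrightarrow> up j" | (down) "\<And>j. Suc j < length ys \<Longrightarrow> down j"
  proof (cases "Suc 0 < length ys \<longrightarrow> up 0")
    case True
    have "up j" if "Suc j < length ys" for j
      using that
    proof (induction j)
      case (Suc j)
      then show ?case using not1[of j] ud[of "Suc j"] by auto
    qed (use True in auto)
    then show ?thesis using that(1) by blast
  next
    case False
    have "down j" if "Suc j < length ys" for j
      using that
    proof (induction j)
      case (Suc j)
      then show ?case using not2[of j] ud[of "Suc j"] by auto
    qed (use False ud in auto)
    then show ?thesis using that(2) by blast
  qed
  then show ?thesis
  proof cases
    case up
    then show ?thesis using that[of ys] map_up[of ys] assms(2) by (auto simp: up_def)
  next
    case down
    have "rev ys ! Suc j = Suc (rev ys ! j) mod n" if "Suc j < length (rev ys)" for j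
      using that down[of "length ys - Suc (Suc j)"] by (auto simp: down_def rev_nth Suc_diff_Suc)
    then show ?thesis using that[of "rev ys" "rev ys ! 0"] map_up[of "rev ys"] assms(2) by auto
  qed
qed

section \<open>Rainbow cycles as windows\<close>

lemma ex_avoiding_vertex:
  assumes "avoids n S l g" "x \<in> S" "x < n"
  obtains y where "l + g \<le> y" "y \<le> l + n" "y mod n = x"
proof -
  obtain y where y: "l + 1 \<le> y" "y < l + 1 + n" "y mod n = x"
    using ex_mod_in_period[OF assms(3)] .
  then show ?thesis using that[of y] assms by (auto simp: avoids_def)
qed

lemma covered_if_rainbow_cycle:
  assumes n: "n \<ge> 3" and xs: "rainbow_cycle (wheel_V n) (wheel_E n) c xs" and S: "S \<subseteq> set xs"
  shows "covered n (rim_colour c n) (spoke_colour c n) S"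
proof (cases "n \<in> set xs")
  case False
  have cyc: "length xs \<ge> 3" "distinct xs" "set xs \<subseteq> {..<n}" "cycle_edges xs \<subseteq> wheel_E n"
    using xs False by (auto simp: rainbow_cycle_def is_cycle_def wheel_V_def le_less)
  have adj: "{xs ! j, xs ! Suc j} \<in> wheel_E n" if "Suc j < length xs" for j
    using that cyc(4) edge_in_cycle_edges[of j xs] by (auto simp: subset_iff)
  obtain zs a where zs: "zs = xs \<or> zs = rev xs" "zs = map (\<lambda>j. j mod n) [a..<a + length xs]"
    using rim_path_monotone[OF cyc(2,3) adj] .
  have rz: "rainbow_cycle (wheel_V n) (wheel_E n) c zs"
    using zs(1) xs rainbow_cycle_rev by metis
  let ?m = "length xs"
  have nth: "zs ! j = (a + j) mod n" if "j < ?m" for j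
    using that zs(2) by simp
  have lz: "length zs = ?m" using zs(2) by simp
  have mn: "?m \<le> n"
    using cyc(2,3) by (metis card_lessThan card_mono distinct_card finite_lessThan)
  have "{zs ! (?m - 1), zs ! 0} \<in> cycle_edges zs"
  proof -
    have "Suc (?m - 1) = ?m" using cyc(1) by simp
    then show ?thesis using edge_in_cycle_edges[of "?m - 1" zs] lz cyc(1) by simp
  qed
  then have "{zs ! (?m - 1), zs ! 0} \<in> wheel_E n"
    using rz by (auto simp: rainbow_cycle_def is_cycle_def)
  \<comment> \<open>The closing edge joins the ends of a monotone path: either the path goes all
    round the rim, or it has just two vertices, which its length excludes.\<close>
  then have "a mod n = Suc (a + ?m - 1) mod n \<or> (a + ?m - 1) mod n = Suc a mod n"
  proof -
    have "zs ! (?m - 1) = (a + ?m - 1) mod n" "zs ! 0 = a mod n"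
      using nth[of "?m - 1"] nth[of 0] cyc(1) by fastforce+
    then show ?thesis
      using \<open>{zs ! (?m - 1), zs ! 0} \<in> wheel_E n\<close> n by (simp add: rim_edge_iff mod_Suc_eq)
  qed
  then have "?m = n"
  proof
    assume "a mod n = Suc (a + ?m - 1) mod n"
    moreover have "Suc (a + ?m - 1) = a + ?m" using cyc(1) by simp
    ultimately have "a mod n = (a + ?m) mod n" by metis
    then show ?thesis
      using mod_inj_on_period[of a n "a + ?m" a] mn cyc(1) by (cases "?m = n") auto
  next
    assume "(a + ?m - 1) mod n = Suc a mod n"
    then have "a + ?m - 1 = Suc a"
      by (rule mod_inj_on_period[of _ _ _ a]) (use cyc(1) mn n in auto)
    then show ?thesis using cyc(1) by simp
  qed
  have "set xs = {..<n}"
    using cyc(2,3) \<open>?m = n\<close> by (metis card_lessThan card_subset_eq distinct_card finite_lessThan)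
  then have nS: "n \<notin> S" using S by auto
  have edge: "{i mod n, Suc i mod n} \<in> cycle_edges zs" if i: "i < n" for i
  proof -
    obtain y where y: "a \<le> y" "y < a + n" "y mod n = i"
      using ex_mod_in_period[OF i] .
    have "zs ! (y - a) = i mod n"
      using nth[of "y - a"] y i \<open>?m = n\<close> by simp
    moreover have "zs ! (Suc (y - a) mod n) = Suc i mod n"
    proof -
      have "zs ! (Suc (y - a) mod n) = (a + Suc (y - a)) mod n"
        using nth[of "Suc (y - a) mod n"] \<open>?m = n\<close> n by (simp add: mod_add_right_eq)
      also have "a + Suc (y - a) = Suc y" using y by simp
      finally show ?thesis using mod_Suc_eq[of y n] y(3) by simp
    qed
    ultimately show ?thesis
      using edge_in_cycle_edges[of "y - a" zs] y lz \<open>?m = n\<close> by auto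
  qed
  have "inj_on (c \<circ> (\<lambda>i. {i mod n, Suc i mod n})) {..<n}"
  proof (rule comp_inj_on)
    show "inj_on (\<lambda>i. {i mod n, Suc i mod n}) {..<n}"
    proof (rule inj_onI)
      fix x y assume "x \<in> {..<n}" "y \<in> {..<n}" "{x mod n, Suc x mod n} = {y mod n, Suc y mod n}"
      then show "x = y" using n by (auto simp: doubleton_eq_iff mod_Suc split: if_splits)
    qed
    show "inj_on c ((\<lambda>i. {i mod n, Suc i mod n}) ` {..<n})"
      by (rule inj_on_subset[of _ "cycle_edges zs"]) (use rz edge in \<open>auto simp: rainbow_cycle_def\<close>)
  qed
  then have "inj_on (rim_colour c n) {..<n}"
    by (simp add: rim_colour_def[abs_def] comp_def)
  then show ?thesis using nS by (simp add: covered_def)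
next
  case True
  then obtain as bs where ab: "xs = as @ n # bs"
    using split_list by metis
  define ys where "ys = bs @ as"
  have rot: "rotate (length as) xs = n # ys"
    by (simp add: ab ys_def rotate_append)
  have ry: "rainbow_cycle (wheel_V n) (wheel_E n) c (n # ys)"
    using xs rainbow_cycle_rotate rot by metis
  have Sy: "S \<subseteq> insert n (set ys)"
    using S by (auto simp: ab ys_def)
  have cyc: "length ys \<ge> 2" "distinct ys" "set ys \<subseteq> {..<n}" "cycle_edges (n # ys) \<subseteq> wheel_E n"
    using ry by (auto simp: rainbow_cycle_def is_cycle_def wheel_V_def le_less subset_iff)
  have ne: "ys \<noteq> []" using cyc(1) by auto
  have adj: "{ys ! j, ys ! Suc j} \<in> wheel_E n" if "Suc j < length ys" for j
    using that cyc(4) cycle_edges_Cons[OF ne, of n] by blast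
  obtain zs a0 where zs0: "zs = ys \<or> zs = rev ys" "zs = map (\<lambda>j. j mod n) [a0..<a0 + length ys]"
    using rim_path_monotone[OF cyc(2,3) adj] .
  \<comment> \<open>Raising the start by a period makes room below it for the omitted window, which
    begins at \<open>a0 + m - 1\<close>, a representative of the last path vertex.\<close>
  define a where "a = a0 + n"
  have zs: "zs = ys \<or> zs = rev ys" "zs = map (\<lambda>j. j mod n) [a..<a + length ys]"
  proof -
    have "map (\<lambda>j. j mod n) [a0..<a0 + length ys] = map (\<lambda>j. j mod n) [a..<a + length ys]"
    proof (rule nth_equalityI)
      fix i assume "i < length (map (\<lambda>j. j mod n) [a0..<a0 + length ys])"
      moreover have "(a + i) mod n = (a0 + i + n) mod n" by (simp add: a_def ac_simps)
      ultimately show "map (\<lambda>j. j mod n) [a0..<a0 + length ys] ! i = map (\<lambda>j. j mod n) [a..<a + length ys] ! i"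
        by simp
    qed simp
    then show "zs = map (\<lambda>j. j mod n) [a..<a + length ys]" using zs0(2) by simp
  qed (rule zs0(1))
  define m where "m = length ys"
  have m: "2 \<le> m" "m \<le> n"
    using cyc card_mono[of "{..<n}" "set ys"] by (auto simp: m_def distinct_card)
  have nez: "zs \<noteq> []" using zs ne by auto
  have "cycle_edges (n # ys) = cycle_edges (n # zs)"
  proof (cases "zs = ys")
    case False
    have "rotate (length ys) (rev (n # ys)) = n # rev ys"
      using rotate_append[of "rev ys" "[n]"] by simp
    then show ?thesis using False zs(1) by (metis cycle_edges_rotate cycle_edges_rev)
  qed simp
  also have "\<dots> = insert {n, a mod n} (insert {n, (a + m - 1) mod n}
      {{zs ! j, zs ! Suc j} | j. Suc j < m})"
  proof -
    have "hd zs = a mod n" "last zs = (a + m - 1) mod n" "length zs = m"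
      using m unfolding zs(2) m_def[symmetric] by (auto simp: hd_map last_map)
    then show ?thesis using cycle_edges_Cons[OF nez, of n] by simp
  qed
  also have "{{zs ! j, zs ! Suc j} | j. Suc j < m} =
      (\<lambda>i. {i mod n, Suc i mod n}) ` {a..<a + m - 1}" (is "?A = ?B")
  proof
    show "?A \<subseteq> ?B" using m unfolding zs(2) m_def[symmetric] by auto
    show "?B \<subseteq> ?A"
    proof
      fix e assume "e \<in> ?B"
      then obtain i where i: "a \<le> i" "i < a + m - 1" "e = {i mod n, Suc i mod n}" by auto
      then have "Suc (i - a) < m" "e = {zs ! (i - a), zs ! Suc (i - a)}"
        unfolding zs(2) m_def[symmetric] by auto
      then show "e \<in> ?A" by blast
    qed
  qed
  finally have edges: "cycle_edges (n # ys) = insert {n, a mod n} (insert {n, (a + m - 1) mod n}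
      ((\<lambda>i. {i mod n, Suc i mod n}) ` {a..<a + m - 1}))" .
  have inj: "inj_on c (cycle_edges (n # ys))"
    using ry by (simp add: rainbow_cycle_def)
  define l where "l = a0 + m - 1"
  define g where "g = n - m + 1"
  have lg: "l + g = a" "l + n = a + m - 1" "1 \<le> g" "g < n"
    using m by (auto simp: l_def g_def a_def)
  have sa: "spoke_colour c n a = c {n, a mod n}"
    by (simp add: spoke_colour_def insert_commute)
  have sl: "spoke_colour c n l = c {n, (a + m - 1) mod n}"
    unfolding lg(2)[symmetric] by (simp add: spoke_colour_def insert_commute)
  have rim_ne: "{n, x} \<noteq> {i mod n, Suc i mod n}" for x i
    using n by (metis insertI1 insertE less_irrefl mod_less_divisor not_numeral_le_zero not_gr_zero singletonD)
  have neq: "a mod n \<noteq> (a + m - 1) mod n"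
  proof
    assume "a mod n = (a + m - 1) mod n"
    then have "a = a + m - 1"
      by (rule mod_inj_on_period[of _ _ _ a]) (use m in auto)
    then show False using m by simp
  qed
  have "inj_on (c \<circ> (\<lambda>i. {i mod n, Suc i mod n})) {a..<a + m - 1}"
  proof (rule comp_inj_on)
    show "inj_on (\<lambda>i. {i mod n, Suc i mod n}) {a..<a + m - 1}"
    proof (rule inj_onI)
      fix x y assume x: "x \<in> {a..<a + m - 1}" and y: "y \<in> {a..<a + m - 1}"
        and eq: "{x mod n, Suc x mod n} = {y mod n, Suc y mod n}"
      have "{x mod n, Suc (x mod n) mod n} = {y mod n, Suc (y mod n) mod n}"
        using eq by (simp add: mod_Suc_eq)
      moreover have "x mod n < n" "y mod n < n" using n by auto
      ultimately have "x mod n = y mod n"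
        using n by (auto simp: doubleton_eq_iff mod_Suc split: if_splits)
      then show "x = y"
        by (rule mod_inj_on_period[of _ _ _ a]) (use x y m in auto)
    qed
    show "inj_on c ((\<lambda>i. {i mod n, Suc i mod n}) ` {a..<a + m - 1})"
      by (rule inj_on_subset[OF inj]) (auto simp: edges)
  qed
  then have "inj_on (rim_colour c n) {a..<a + m - 1}"
    by (simp add: rim_colour_def[abs_def] comp_def)
  moreover have "spoke_colour c n l \<noteq> spoke_colour c n a"
  proof
    assume "spoke_colour c n l = spoke_colour c n a"
    then have "{n, (a + m - 1) mod n} = {n, a mod n}"
      unfolding sa sl by (rule inj_onD[OF inj]) (auto simp: edges)
    then show False using neq by (auto simp: doubleton_eq_iff)
  qed
  moreover have "c {n, x} \<notin> rim_colour c n ` {a..<a + m - 1}"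
    if "{n, x} \<in> cycle_edges (n # ys)" for x
  proof
    assume "c {n, x} \<in> rim_colour c n ` {a..<a + m - 1}"
    then obtain i where i: "i \<in> {a..<a + m - 1}" "c {n, x} = c {i mod n, Suc i mod n}"
      by (auto simp: rim_colour_def)
    then have "{n, x} = {i mod n, Suc i mod n}"
      using that by (intro inj_onD[OF inj i(2)]) (auto simp: edges)
    then show False using rim_ne by blast
  qed
  then have "spoke_colour c n l \<notin> rim_colour c n ` {a..<a + m - 1}"
    "spoke_colour c n a \<notin> rim_colour c n ` {a..<a + m - 1}"
    unfolding sa sl by (auto simp: edges)
  ultimately have "gap n (rim_colour c n) (spoke_colour c n) l g"
    using lg by (simp add: gap_def)
  moreover have "avoids n S l g"
    unfolding avoids_def
  proof (intro allI impI notI)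
    fix x assume x: "x mod n \<in> S" "l < x \<and> x < l + g"
    have "x mod n \<noteq> n" using n by (metis less_irrefl mod_less_divisor not_numeral_le_zero not_gr_zero)
    then have "x mod n \<in> set zs" using x(1) Sy zs(1) by auto
    then obtain y where y: "a0 \<le> y" "y < a0 + m" "x mod n = y mod n"
      unfolding zs0(2) m_def by auto
    have "x = y"
      by (rule mod_inj_on_period[OF y(3), of a0]) (use x(2) y m lg a_def l_def in auto)
    then show False using x y by (auto simp: l_def)
  qed
  ultimately show ?thesis by (auto simp: covered_def)
qed

lemma rainbow_cycle_if_covered:
  assumes n: "n \<ge> 3" and cov: "covered n (rim_colour c n) (spoke_colour c n) S" and S: "S \<subseteq> {0..n}"
  obtains xs where "rainbow_cycle (wheel_V n) (wheel_E n) c xs" "S \<subseteq> set xs"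
proof -
  have rimE: "{i mod n, Suc i mod n} \<in> wheel_E n" and spokeE: "{n, i mod n} \<in> wheel_E n" for i
    using rim_edge_in_wheel_E[of n i] spoke_in_wheel_E[of n i] n by simp_all
  consider (rim) "inj_on (rim_colour c n) {..<n}" "n \<notin> S"
    | (hub) l g where "gap n (rim_colour c n) (spoke_colour c n) l g" "avoids n S l g"
    using cov by (auto simp: covered_def)
  then show ?thesis
  proof cases
    case rim
    have e: "cycle_edges [0..<n] = (\<lambda>i. {i mod n, Suc i mod n}) ` {..<n}"
    proof -
      have "{[0..<n] ! i, [0..<n] ! (Suc i mod n)} = {i mod n, Suc i mod n}" if "i < n" for i
        using that n by simp
      then show ?thesis by (force simp: cycle_edges_def)
    qed
    have "inj_on c (cycle_edges [0..<n])"
      unfolding e by (rule inj_on_imageI) (use rim(1) in \<open>simp add: comp_def rim_colour_def[abs_def]\<close>)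
    moreover have "is_cycle (wheel_V n) (wheel_E n) [0..<n]"
    proof -
      have "cycle_edges [0..<n] \<subseteq> wheel_E n" unfolding e using rimE by blast
      then show ?thesis using n by (auto simp: is_cycle_def wheel_V_def)
    qed
    moreover have "S \<subseteq> set [0..<n]"
      using S rim(2) by (auto simp: le_less)
    ultimately show ?thesis using that by (auto simp: rainbow_cycle_def)
  next
    case hub
    define ys where "ys = map (\<lambda>j. j mod n) [l + g..<Suc (l + n)]"
    have g: "1 \<le> g" "g < n" using hub(1) by (auto simp: gap_def)
    have len: "length ys = n - g + 1" using g by (simp add: ys_def)
    then have ne: "ys \<noteq> []" by auto
    have nth: "ys ! j = (l + g + j) mod n" if "j < length ys" for j
      using that len g unfolding ys_def by (subst nth_map) (auto simp del: upt_Suc)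
    have hd: "hd ys = (l + g) mod n" using nth[of 0] ne by (simp add: hd_conv_nth)
    have last: "last ys = l mod n"
      using nth[of "n - g"] ne len g by (simp add: last_conv_nth)
    have set: "set ys = (\<lambda>j. j mod n) ` {l + g..l + n}"
      by (auto simp: ys_def)
    have dist: "distinct ys"
      unfolding ys_def distinct_map
      by (auto intro!: inj_onI simp del: upt_Suc) (rule mod_inj_on_period[of _ n _ "l + g"], use g in auto)
    have edges: "cycle_edges (n # ys) = insert {n, (l + g) mod n} (insert {n, l mod n}
        {{ys ! j, ys ! Suc j} | j. Suc j < length ys})"
      using cycle_edges_Cons[OF ne] hd last by simp
    have A: "{{ys ! j, ys ! Suc j} | j. Suc j < length ys}
        \<subseteq> (\<lambda>i. {i mod n, Suc i mod n}) ` {l + g..<l + n}" (is "?A \<subseteq> ?B")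
    proof clarify
      fix j assume "Suc j < length ys"
      then show "{ys ! j, ys ! Suc j} \<in> ?B"
        using len by (intro image_eqI[of _ _ "l + g + j"]) (auto simp: nth)
    qed
    have "inj_on c ?B"
      by (rule inj_on_imageI)
        (use hub(1) in \<open>simp add: gap_def comp_def rim_colour_def[abs_def]\<close>)
    moreover have "c {n, (l + g) mod n} \<noteq> c {n, l mod n}" "c {n, l mod n} \<notin> c ` ?B"
        "c {n, (l + g) mod n} \<notin> c ` ?B"
      using hub(1) by (auto simp: gap_def rim_colour_def[abs_def] spoke_colour_def insert_commute)
    ultimately have "inj_on c (insert {n, (l + g) mod n} (insert {n, l mod n} ?B))"
      by (auto simp: inj_on_insert)
    then have "inj_on c (cycle_edges (n # ys))"
      unfolding edges by (rule inj_on_subset) (use A in blast)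
    moreover have "is_cycle (wheel_V n) (wheel_E n) (n # ys)"
    proof -
      have "cycle_edges (n # ys) \<subseteq> wheel_E n"
        unfolding edges by (intro insert_subsetI spokeE subset_trans[OF A] image_subsetI rimE)
      moreover have "set ys \<subseteq> {..<n}" using n by (auto simp: set)
      ultimately show ?thesis using len g dist by (auto simp: is_cycle_def wheel_V_def)
    qed
    moreover have "S \<subseteq> set (n # ys)"
    proof
      fix x assume x: "x \<in> S"
      show "x \<in> set (n # ys)"
      proof (cases "x = n")
        case False
        then have "x < n" using x S by auto
        then obtain y where "l + g \<le> y" "y \<le> l + n" "y mod n = x"
          using ex_avoiding_vertex[OF hub(2) x] by blast
        then show ?thesis by (auto simp: set)
      qed simp
    qed
    ultimately show ?thesis using that by (auto simp: rainbow_cycle_def)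
  qed
qed

text \<open>Reduces the problem to two periodic functions on the naturals.\<close>

lemma k_rainbow_iff_covered:
  assumes "n \<ge> 3"
  shows "k_rainbow_cycle_colouring (wheel_V n) (wheel_E n) k c \<longleftrightarrow>
    (\<forall>S. S \<subseteq> {0..n} \<and> card S = k \<longrightarrow> covered n (rim_colour c n) (spoke_colour c n) S)"
  unfolding k_rainbow_cycle_colouring_def
  using covered_if_rainbow_cycle[OF assms] rainbow_cycle_if_covered[OF assms]
  by (metis wheel_V_def)

lemma wheel_colours:
  "c ` wheel_E n = rim_colour c n ` {..<n} \<union> spoke_colour c n ` {..<n}"
  by (simp add: wheel_E_image image_Un image_image rim_colour_def spoke_colour_def)

section \<open>Colourings\<close>

lemma rim_edge_inj:
  assumes "n \<ge> 3" "x < n" "y < n" "{x, Suc x mod n} = {y, Suc y mod n}"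
  shows "x = y"
  using assms by (auto simp: doubleton_eq_iff mod_Suc split: if_splits)

text \<open>For \<open>n \<ge> 3\<close> an edge determines its kind and its index, so both
  functions can be prescribed freely.\<close>

lemma ex_colouring:
  fixes r s :: "nat \<Rightarrow> nat"
  assumes n: "n \<ge> 3"
  obtains c where "rim_colour c n = (\<lambda>i. r (i mod n))" "spoke_colour c n = (\<lambda>i. s (i mod n))"
proof -
  define c where "c e = (if n \<in> e then s (THE i. i < n \<and> e = {i, n})
    else r (THE i. i < n \<and> e = {i, Suc i mod n}))" for e
  have "rim_colour c n i = r (i mod n)" for i
  proof -
    have lt: "i mod n < n" "Suc i mod n < n" using n by auto
    then have "n \<notin> {i mod n, Suc i mod n}" by (metis insertE less_irrefl singletonD)
    moreover have "(THE j. j < n \<and> {i mod n, Suc i mod n} = {j, Suc j mod n}) = i mod n"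
    proof (rule the_equality)
      show "i mod n < n \<and> {i mod n, Suc i mod n} = {i mod n, Suc (i mod n) mod n}"
        using lt by (simp add: mod_Suc_eq)
      fix j assume "j < n \<and> {i mod n, Suc i mod n} = {j, Suc j mod n}"
      then show "j = i mod n"
        using rim_edge_inj[OF n, of j "i mod n"] lt by (simp add: mod_Suc_eq)
    qed
    ultimately show ?thesis by (simp add: rim_colour_def c_def)
  qed
  moreover have "spoke_colour c n i = s (i mod n)" for i
  proof -
    have "i mod n < n" using n by auto
    then have "(THE j. j < n \<and> {i mod n, n} = {j, n}) = i mod n"
      by (intro the_equality) (auto simp: doubleton_eq_iff)
    then show ?thesis by (simp add: spoke_colour_def c_def)
  qed
  ultimately show ?thesis using that[of c] by auto
qed

text \<open>\<open>A\<close> may be any set of residues that contains the retained rim edges, so no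
  wrapped interval has to be described exactly.\<close>

lemma gapI:
  assumes "1 \<le> g" "g < n" "\<And>i. l + g \<le> i \<Longrightarrow> i < l + n \<Longrightarrow> i mod n \<in> A" "inj_on r A"
    and "s (l mod n) \<noteq> s ((l + g) mod n)" "s (l mod n) \<notin> r ` A" "s ((l + g) mod n) \<notin> r ` A"
  shows "gap n (\<lambda>i. r (i mod n)) (\<lambda>i. s (i mod n)) l g"
proof -
  have "inj_on (\<lambda>i. r (i mod n)) {l + g..<l + n}"
  proof (rule inj_onI)
    fix x y assume xy: "x \<in> {l + g..<l + n}" "y \<in> {l + g..<l + n}" "r (x mod n) = r (y mod n)"
    then have "x mod n = y mod n" using assms(3,4) by (meson atLeastLessThan_iff inj_onD)
    then show "x = y" by (rule mod_inj_on_period[of _ _ _ l]) (use xy in auto)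
  qed
  then show ?thesis unfolding gap_def using assms by force
qed

lemma mod_less_twice: "i mod n = (if i < n then i else i - n)" if "i < 2 * n" for i n :: nat
  using that by (simp add: mod_if)

lemma gapI_inner:
  assumes "1 \<le> g" "g < n" "l + g \<le> n" "inj_on r ({..<l} \<union> {l + g..<n})"
    and "s l \<noteq> s ((l + g) mod n)" "s l \<notin> r ` ({..<l} \<union> {l + g..<n})"
    "s ((l + g) mod n) \<notin> r ` ({..<l} \<union> {l + g..<n})"
  shows "gap n (\<lambda>i. r (i mod n)) (\<lambda>i. s (i mod n)) l g"
  by (rule gapI[of _ _ _ "{..<l} \<union> {l + g..<n}"])
    (use assms in \<open>auto simp: mod_less_twice split: if_splits\<close>)

text \<open>The closing window of a staircase: it passes vertex 0 and ends at vertex 1, sharing edge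
  0 with a window that starts at 0.\<close>

lemma gapI_wrap:
  assumes "l < n" "g < n" "l + g = n + 1" "inj_on r {1..<l}"
    and "s l \<noteq> s 1" "s l \<notin> r ` {1..<l}" "s 1 \<notin> r ` {1..<l}"
  shows "gap n (\<lambda>i. r (i mod n)) (\<lambda>i. s (i mod n)) l g"
proof -
  have "(l + g) mod n = 1" using mod_less_twice[of "l + g" n] assms by auto
  then show ?thesis
    by (intro gapI[of _ _ _ "{1..<l}"])
      (use assms in \<open>auto simp: mod_less_twice split: if_splits\<close>)
qed

text \<open>Pigeonhole: if each window had an interior vertex in \<open>S\<close>, disjointness
  would yield \<open>K\<close> distinct rim vertices of \<open>S\<close>.\<close>

lemma covered_if_disjoint_gaps:
  assumes gaps: "\<And>a. a < K \<Longrightarrow> gap n r s (l a) (g a)"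
    and disj: "\<And>a b x y. \<lbrakk>a < K; b < K; l a < x; x < l a + g a; l b < y; y < l b + g b;
      x mod n = y mod n\<rbrakk> \<Longrightarrow> a = b"
    and n: "n > 0" and S: "finite S" "card (S - {n}) < K"
  shows "covered n r s S"
proof (rule ccontr)
  assume "\<not> covered n r s S"
  then have "\<forall>a<K. \<exists>x. l a < x \<and> x < l a + g a \<and> x mod n \<in> S"
    using gaps unfolding covered_def avoids_def by blast
  then obtain p where p: "\<And>a. a < K \<Longrightarrow> l a < p a \<and> p a < l a + g a \<and> p a mod n \<in> S"
    by metis
  have "inj_on (\<lambda>a. p a mod n) {..<K}"
    by (rule inj_onI) (use p disj in \<open>simp; metis\<close>)
  moreover have "(\<lambda>a. p a mod n) ` {..<K} \<subseteq> S - {n}"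
  proof
    fix v assume "v \<in> (\<lambda>a. p a mod n) ` {..<K}"
    then obtain a where "a < K" "v = p a mod n" by auto
    then show "v \<in> S - {n}" using p n mod_less_divisor[of n "p a"] by fastforce
  qed
  ultimately have "card {..<K} \<le> card (S - {n})"
    using S(1) by (meson card_inj_on_le finite_Diff)
  then show False using S(2) by simp
qed

text \<open>Consecutive windows share an edge but no interior vertex, so each rim vertex spoils at most
  one of the \<open>K\<close> hub cycles.\<close>

lemma covered_by_staircase:
  assumes K: "K \<ge> 1" "q * K \<le> n" "n > 0"
    and inner: "\<And>a. a + 1 < K \<Longrightarrow> gap n r s (q * a) (q + 1)"
    and last: "gap n r s (q * (K - 1)) (n + 1 - q * (K - 1))"
    and S: "finite S" "card (S - {n}) < K"
  shows "covered n r s S"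
proof -
  \<comment> \<open>The last window absorbs the remainder \<open>n - q * K\<close> and ends at
    vertex 1.\<close>
  define g where "g a = (if a + 1 < K then q + 1 else n + 1 - q * (K - 1))" for a
  have up: "q * a + g a \<le> n + 1" if "a < K" for a
  proof (cases "a + 1 < K")
    case True
    then have "q * (a + 1) \<le> q * K" by (intro mult_le_mono2) simp
    then show ?thesis using True K(2) by (simp add: g_def)
  next
    case False
    then have "a = K - 1" using that by simp
    moreover have "q * (K - 1) \<le> q * K" by simp
    then have "q * (K - 1) \<le> n" using K(2) by linarith
    ultimately show ?thesis using False by (simp add: g_def)
  qed
  have le: "\<not> a < b" if "a < K" "b < K" "x < q * a + g a" "q * b < x" for a b x
  proof
    assume "a < b"
    then have "q * (a + 1) \<le> q * b" by (intro mult_le_mono2) simp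
    then show False using that \<open>a < b\<close> by (simp add: g_def)
  qed
  show ?thesis
  proof (rule covered_if_disjoint_gaps[where l = "\<lambda>a. q * a" and g = g])
    fix a assume "a < K"
    show "gap n r s (q * a) (g a)"
    proof (cases "a + 1 < K")
      case False
      then have "a = K - 1" using \<open>a < K\<close> by simp
      then show ?thesis using last False by (simp add: g_def)
    qed (use inner in \<open>simp add: g_def\<close>)
  next
    fix a b x y
    assume ab: "a < K" "b < K" "q * a < x" "x < q * a + g a" "q * b < y" "y < q * b + g b"
      "x mod n = y mod n"
    have "x = y"
      by (rule mod_inj_on_period[OF ab(7), of 1]) (use ab up[of a] up[of b] in auto)
    then show "a = b" using le[of a b x] le[of b a x] ab by simp
  qed (use K S in auto)
qed

section \<open>Colourings for one or two vertices and for the smallest wheel\<close>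

lemma covered_two_colour_spokes:
  assumes n: "n \<ge> 3" and S: "card S = 1"
  shows "covered n (\<lambda>i. (\<lambda>_. 2) (i mod n)) (\<lambda>i. (\<lambda>j. j mod 2) (i mod n)) S"
proof -
  obtain x where x: "S = {x}" using S by (auto simp: card_1_singleton_iff)
  \<comment> \<open>The last rim vertex and the hub use the triangle at \<open>n - 2\<close>; the
    triangle across the seam has two spokes of equal parity when \<open>n\<close> is odd.\<close>
  define p where "p = (if x + 1 < n then x else n - 2)"
  have p: "p + 1 < n" using n by (auto simp: p_def)
  have "gap n (\<lambda>i. (\<lambda>_. 2) (i mod n)) (\<lambda>i. (\<lambda>j. j mod 2) (i mod n)) (p + 1) (n - 1)"
  proof (rule gapI[of _ _ _ "{p}"])
    show "i mod n \<in> {p}" if "p + 1 + (n - 1) \<le> i" "i < p + 1 + n" for i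
    proof -
      have "i = p + n" using that n by simp
      then show ?thesis using p by simp
    qed
    have "(p + 1 + (n - 1)) mod n = p" using p n by simp
    moreover have "(p + 1) mod n = p + 1" using p by simp
    moreover have "(p + 1) mod 2 \<noteq> p mod 2" "(p + 1) mod 2 < 2" "p mod 2 < 2" by presburger+
    ultimately show "(p + 1) mod n mod 2 \<noteq> (p + 1 + (n - 1)) mod n mod 2"
      "(p + 1) mod n mod 2 \<notin> (\<lambda>_. 2) ` {p}" "(p + 1 + (n - 1)) mod n mod 2 \<notin> (\<lambda>_. 2) ` {p}"
      by (simp_all only:) auto
  qed (use n in auto)
  moreover have "avoids n S (p + 1) (n - 1)"
    unfolding avoids_def x
  proof (intro allI impI notI)
    fix y assume y: "y mod n \<in> {x}" "p + 1 < y \<and> y < p + 1 + (n - 1)"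
    have "y mod n < n" using n by simp
    then have "x < n" using y(1) by simp
    moreover have "y mod n = (if y < n then y else y - n)"
      by (rule mod_less_twice) (use y p in auto)
    ultimately show False using y p by (auto simp: p_def split: if_splits)
  qed
  ultimately show ?thesis by (auto simp: covered_def)
qed

text \<open>Each spoke has the colour of the opposite rim edge. This is the proper 3-edge-colouring
  of the complete graph on four vertices, so every triangle is rainbow.\<close>

lemma covered_K4:
  assumes "S \<subseteq> {0..3}" "card S < 4"
  shows "covered 3 (\<lambda>i. (\<lambda>j. j) (i mod 3)) (\<lambda>i. (\<lambda>j. (j + 1) mod 3) (i mod 3)) S"
proof (cases "3 \<in> S")
  case True
  have "\<exists>v<3. v \<notin> S"
  proof (rule ccontr)
    assume "\<not> (\<exists>v<3. v \<notin> S)"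
    then have "{0..3} \<subseteq> S" using True by (auto simp: le_less)
    then have "card {0..3::nat} \<le> card S" using assms(1) by (intro card_mono) (auto intro: finite_subset)
    then show False using assms(2) by simp
  qed
  then obtain v where v: "v < 3" "v \<notin> S" by auto
  have "gap 3 (\<lambda>i. (\<lambda>j. j) (i mod 3)) (\<lambda>i. (\<lambda>j. (j + 1) mod 3) (i mod 3)) (v + 2) 2"
  proof (rule gapI[of _ _ _ "{(v + 1) mod 3}"])
    show "i mod 3 \<in> {(v + 1) mod 3}" if "v + 2 + 2 \<le> i" "i < v + 2 + 3" for i
    proof -
      have "i = v + 1 + 3" using that by simp
      then show ?thesis by (simp only: mod_add_self2 singleton_iff)
    qed
    have "v = 0 \<or> v = 1 \<or> v = 2" using v(1) by auto
    then show "((v + 2) mod 3 + 1) mod 3 \<noteq> ((v + 2 + 2) mod 3 + 1) mod 3"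
      "((v + 2) mod 3 + 1) mod 3 \<notin> (\<lambda>j. j) ` {(v + 1) mod 3}"
      "((v + 2 + 2) mod 3 + 1) mod 3 \<notin> (\<lambda>j. j) ` {(v + 1) mod 3}"
      by auto
  qed auto
  moreover have "avoids 3 S (v + 2) 2"
    unfolding avoids_def
  proof (intro allI impI notI)
    fix x assume "x mod 3 \<in> S" "v + 2 < x \<and> x < v + 2 + 2"
    moreover from this have "x = v + 3" by simp
    ultimately show False using v by simp
  qed
  ultimately show ?thesis by (auto simp: covered_def)
qed (auto simp: covered_def inj_on_def)

text \<open>Two vertices lie on an arc of about half the rim. Such an arc is rainbow by the period
  \<open>H\<close>, and its ends lie in different halves, so their spokes differ.\<close>

lemma covered_half_period:
  assumes n: "n \<ge> 4" and H: "H = (n + 1) div 2" and S: "S \<subseteq> {0..n}" "card S = 2"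
  shows "covered n (\<lambda>i. (\<lambda>j. j mod H) (i mod n)) (\<lambda>i. (\<lambda>j. if j < H then H else H + 1) (i mod n)) S"
proof -
  have H2: "2 * H = n \<or> 2 * H = n + 1" using H by presburger
  let ?s = "\<lambda>j. if j < H then H else H + 1"
  \<comment> \<open>The length of the arc from \<open>p\<close>. For odd \<open>n\<close> the
    pattern skips a colour at the seam, so arcs that may cross it get length
    \<open>n - H = H - 1\<close>; from 0 this would end in the same half, so there \<open>H\<close>
    is taken. For even \<open>n\<close> both values agree.\<close>
  define t where "t p = (if p = 0 then H else n - H)" for p :: nat
  have arc: "gap n (\<lambda>i. (\<lambda>j. j mod H) (i mod n)) (\<lambda>i. ?s (i mod n)) (p + t p) (n - t p)"
    if p: "p < n" for p
  proof -
    have t: "1 \<le> t p" "t p < n" "t p \<le> H" using H2 n by (auto simp: t_def)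
    let ?A = "(\<lambda>i. i mod n) ` {p..<p + t p}"
    have inj: "inj_on (\<lambda>i. i mod n mod H) {p..<p + t p}"
    proof -
      have "False" if ij: "p \<le> i" "i < j" "j < p + t p" "i mod n mod H = j mod n mod H" for i j
      proof -
        have mi: "i mod n = (if i < n then i else i - n)" and mj: "j mod n = (if j < n then j else j - n)"
          by (intro mod_less_twice; use ij p t in linarith)+
        have *: False if "x mod H = y mod H" "x < y" "y < x + H" for x y
          using mod_inj_on_period[OF that(1), of x] that by auto
        show False
        proof (cases "i < n \<and> n \<le> j")
          case False
          then have "i mod n < j mod n" "j mod n < i mod n + H"
            using ij t unfolding mi mj by (auto split: if_splits)
          then show False using *[OF ij(4)] by blast
        next
          \<comment> \<open>The edges lie on both sides of the seam. Adding \<open>2 * H\<close> to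
            \<open>j - n\<close> keeps its colour and gives \<open>j\<close> for even and
            \<open>j + 1\<close> for odd \<open>n\<close>, still less than \<open>H\<close> beyond
            \<open>i\<close>.\<close>
          case True
          then have p0: "p \<noteq> 0" using ij t by auto
          then have tp: "t p = n - H" by (simp add: t_def)
          show False
          proof (cases "2 * H = n")
            case True2: True
            have "(j - n + 2 * H) mod H = (j - n) mod H" by simp
            then have "i mod H = j mod H" using True True2 ij(4) mi mj by simp
            moreover have "j < i + H" using ij t by linarith
            ultimately show False using *[of i j] ij(2) by blast
          next
            case False
            then have "j - n + 2 * H = j + 1" using H2 True by auto
            moreover have "(j - n + 2 * H) mod H = (j - n) mod H" by simp
            ultimately have "i mod H = (j + 1) mod H" using True ij(4) mi mj by simp
            moreover have "i < j + 1" "j + 1 < i + H" using ij tp H2 False by auto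
            ultimately show False using *[of i "j + 1"] by blast
          qed
        qed
      qed
      then show ?thesis by (intro linorder_inj_onI') auto
    qed
    show ?thesis
    proof (rule gapI[of _ _ _ ?A])
      show "i mod n \<in> ?A" if "p + t p + (n - t p) \<le> i" "i < p + t p + n" for i
      proof -
        have "i mod n = (i - n) mod n" using that t by (simp add: le_mod_geq)
        then show ?thesis using that t by (intro image_eqI[of _ _ "i - n"]) auto
      qed
      show "inj_on (\<lambda>j. j mod H) ?A"
        by (rule inj_on_imageI) (use inj in \<open>simp add: comp_def\<close>)
      have "H > 0" using H2 n by auto
      then have "(\<lambda>j. j mod H) ` ?A \<subseteq> {..<H}" by auto
      moreover have "?s x \<notin> {..<H}" for x by simp
      ultimately show "?s ((p + t p) mod n) \<notin> (\<lambda>j. j mod H) ` ?A"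
        "?s ((p + t p + (n - t p)) mod n) \<notin> (\<lambda>j. j mod H) ` ?A"
        by blast+
      have "(p + t p + (n - t p)) mod n = p" using p t by simp
      moreover have "(p + t p) mod n < H \<longleftrightarrow> \<not> p < H"
      proof -
        have w: "(p + t p) mod n = (if p + t p < n then p + t p else p + t p - n)"
          by (rule mod_less_twice) (use p t in linarith)
        have H: "n \<le> 2 * H" "2 * H \<le> n + 1" "H < n" using H2 n by auto
        consider "p = 0" | "0 < p" "p < H" | "H \<le> p" by linarith
        then show ?thesis
        proof cases
          case 1
          then show ?thesis using w H by (simp add: t_def)
        next
          case 2
          then have "t p = n - H" by (simp add: t_def)
          then have "p + t p < n" "H \<le> p + t p" using 2 H by linarith+
          then show ?thesis using w 2 by simp
        next
          case 3
          then have "t p = n - H" using H p by (simp add: t_def)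
          then have "\<not> p + t p < n" "p + t p - n < H" using 3 H p by linarith+
          then show ?thesis using w 3 by simp
        qed
      qed
      ultimately show "?s ((p + t p) mod n) \<noteq> ?s ((p + t p + (n - t p)) mod n)"
        by simp
    qed (use t in auto)
  qed
  \<comment> \<open>A hub in \<open>S\<close> imposes nothing, so the other vertex is then taken
    twice.\<close>
  obtain x y where xy: "x \<le> y" "y < n" "S \<subseteq> {x, y, n}"
  proof -
    obtain u v where uv: "S = {u, v}" "u \<noteq> v" using S(2) by (auto simp: card_2_iff)
    show ?thesis
    proof (cases "u = n \<or> v = n")
      case True
      then show ?thesis using that[of u u] that[of v v] uv S(1) by auto
    next
      case False
      then show ?thesis using that[of u v] that[of v u] uv S(1) by (cases "u \<le> v") auto
    qed
  qed
  \<comment> \<open>One of the two arcs between \<open>x\<close> and \<open>y\<close> has at most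
    \<open>n - H\<close> edges; \<open>p\<close> is where it starts.\<close>
  define p where "p = (if y - x \<le> n - H then x else y)"
  have "p < n" using xy by (auto simp: p_def)
  moreover have "avoids n S (p + t p) (n - t p)"
    unfolding avoids_def
  proof (intro allI impI notI)
    fix z assume z: "z mod n \<in> S" "p + t p < z \<and> z < p + t p + (n - t p)"
    have tn: "t p < n" using H2 n by (auto simp: t_def)
    have "z mod n < n" using n by simp
    moreover have "z mod n \<in> {x, y, n}" using z(1) xy(3) by blast
    ultimately have zm: "z mod n = x \<or> z mod n = y" by auto
    have "z mod n = (if z < n then z else z - n)"
      by (rule mod_less_twice) (use z \<open>p < n\<close> tn in linarith)
    then have z2: "z = z mod n \<or> z = z mod n + n" by (auto split: if_splits)
    have tb: "n - H \<le> t p" using H2 n by (auto simp: t_def)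
    have H: "2 * H \<le> n + 1" "H < n" using H2 n by auto
    show False
    proof (cases "y - x \<le> n - H")
      case True
      then have "p = x" by (simp add: p_def)
      then show False using z(2) zm z2 tb True xy(1) tn by linarith
    next
      case False
      then have "p = y" by (simp add: p_def)
      then show False using z(2) zm z2 tb False xy(1) tn H by linarith
    qed
  qed
  ultimately show ?thesis using arc by (auto simp: covered_def)
qed

section \<open>Colourings for three vertices\<close>

definition crossing_rim :: "nat \<Rightarrow> nat \<Rightarrow> nat" where
  "crossing_rim q i = (if i = 2 * q then 0 else if i = 3 * q then q else i)"

text \<open>For \<open>q > 0\<close> exactly the edges \<open>0\<close>, \<open>2 * q\<close> and
  the edges \<open>q\<close>, \<open>3 * q\<close> share a colour. These pairs alternate around the
  rim, as the lower bound forces for two repeats.\<close>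

lemma inj_on_crossing_rim:
  assumes "\<not> {0, 2 * q} \<subseteq> A" "\<not> {q, 3 * q} \<subseteq> A"
  shows "inj_on (crossing_rim q) A"
  using assms by (auto simp: inj_on_def crossing_rim_def split: if_splits) (metis gr0I)+

lemma crossing_rim_range:
  assumes "0 < q" "3 * q < n"
  shows "crossing_rim q ` {..<n} \<subseteq> {..<n} - {2 * q, 3 * q}"
  using assms by (auto simp: crossing_rim_def)

lemma card_crossing_rim_colours:
  assumes "0 < q" "3 * q < n" "n \<le> m"
  shows "card ({..<m} - {2 * q, 3 * q}) = m - 2"
  using assms by (subst card_Diff_subset) auto

text \<open>The two repeated rim colours alternate around the rim, so every window of the staircase
  contains one edge of each, and its end spokes take the colours freed inside the window.\<close>

lemma covered_crossing_rim:
  assumes q: "0 < q" "4 * q \<le> n"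
    and neq: "\<And>a. a < 3 \<Longrightarrow> s (q * a) \<noteq> s ((q * a + q + 1) mod n)" "s (3 * q) \<noteq> s 1"
    and left: "\<And>a. a < 3 \<Longrightarrow> q * a < s (q * a) \<and> s (q * a) < q * a + q \<or> n \<le> s (q * a)"
      "3 * q < s (3 * q)"
    and right: "\<And>a. a < 3 \<Longrightarrow> q * a < s ((q * a + q + 1) mod n) \<and> s ((q * a + q + 1) mod n) < q * a + q
        \<or> n \<le> s ((q * a + q + 1) mod n)"
      "3 * q < s 1"
    and S: "finite S" "card (S - {n}) < 4"
  shows "covered n (\<lambda>i. crossing_rim q (i mod n)) (\<lambda>i. s (i mod n)) S"
proof (rule covered_by_staircase[where K = 4 and q = q])
  fix a :: nat assume "a + 1 < 4"
  then have a: "a < 3" "a = 0 \<or> a = 1 \<or> a = 2" by auto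
  let ?A = "{..<q * a} \<union> {q * a + (q + 1)..<n}"
  have inj: "inj_on (crossing_rim q) ?A"
    by (rule inj_on_crossing_rim; use a q in auto)
  \<comment> \<open>The colours of the end edges \<open>q * a\<close> and \<open>q * a + q\<close>
    survive on their partners outside the window, so only the \<open>q - 1\<close> colours strictly
    between are freed. Colours from \<open>n\<close> on never occur on the rim.\<close>
  have free: "x \<notin> crossing_rim q ` ?A" if "q * a < x \<and> x < q * a + q \<or> n \<le> x" for x
    using that a(2) q by (auto simp: crossing_rim_def)
  show "gap n (\<lambda>i. crossing_rim q (i mod n)) (\<lambda>i. s (i mod n)) (q * a) (q + 1)"
  proof (rule gapI_inner[OF _ _ _ inj])
    show "s (q * a) \<notin> crossing_rim q ` ?A"
      using free left(1)[OF a(1)] by blast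
    show "s ((q * a + (q + 1)) mod n) \<notin> crossing_rim q ` ?A"
      using free right(1)[OF a(1)] by (simp add: add.assoc)
    show "s (q * a) \<noteq> s ((q * a + (q + 1)) mod n)"
      using neq(1)[OF a(1)] by (simp add: add.assoc)
  qed (use q a in auto)
next
  have inj: "inj_on (crossing_rim q) {1..<3 * q}"
    by (rule inj_on_crossing_rim) auto
  have free: "x \<notin> crossing_rim q ` {1..<3 * q}" if "3 * q < x" for x
    using that by (auto simp: crossing_rim_def)
  have "gap n (\<lambda>i. crossing_rim q (i mod n)) (\<lambda>i. s (i mod n)) (3 * q) (n + 1 - 3 * q)"
    by (rule gapI_wrap) (use inj free q neq(2) left(2) right(2) in auto)
  then show "gap n (\<lambda>i. crossing_rim q (i mod n)) (\<lambda>i. s (i mod n)) (q * (4 - 1)) (n + 1 - q * (4 - 1))"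
    by (simp add: mult.commute)
qed (use assms in auto)

text \<open>With \<open>q = 3\<close> every window frees two colours: its left spoke takes the first
  and its right spoke the second.\<close>

definition spokes_3 :: "nat \<Rightarrow> nat" where
  "spokes_3 j = (if j = 1 then 11 else if j \<in> {4, 7, 10} then j - 2 else if j \<in> {3, 6, 9} then j + 1 else 1)"

lemma covered_spokes_3:
  assumes "n \<ge> 12" "finite S" "card (S - {n}) < 4"
  shows "covered n (\<lambda>i. crossing_rim 3 (i mod n)) (\<lambda>i. spokes_3 (i mod n)) S"
proof (rule covered_crossing_rim)
  fix a :: nat assume "a < 3"
  then have "a = 0 \<or> a = 1 \<or> a = 2" by auto
  then show "3 * a < spokes_3 (3 * a) \<and> spokes_3 (3 * a) < 3 * a + 3 \<or> n \<le> spokes_3 (3 * a)"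
    "3 * a < spokes_3 ((3 * a + 3 + 1) mod n) \<and> spokes_3 ((3 * a + 3 + 1) mod n) < 3 * a + 3 \<or> n \<le> spokes_3 ((3 * a + 3 + 1) mod n)"
    "spokes_3 (3 * a) \<noteq> spokes_3 ((3 * a + 3 + 1) mod n)"
    using assms(1) by (elim disjE; simp add: spokes_3_def)+
qed (use assms in \<open>auto simp: spokes_3_def\<close>)

lemma spokes_3_range: "n \<ge> 12 \<Longrightarrow> spokes_3 ` {..<n} \<subseteq> {..<n} - {6, 9}"
  by (auto simp: spokes_3_def)

text \<open>With \<open>q = 2\<close> each window is only sure to free one colour, which goes to its
  left spoke; all right spokes share the new colour \<open>n\<close>.\<close>

definition spokes_2 :: "nat \<Rightarrow> nat \<Rightarrow> nat" where
  "spokes_2 n j = (if j \<in> {0, 2, 4, 6} then j + 1 else n)"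

lemma covered_spokes_2:
  assumes "n \<ge> 8" "finite S" "card (S - {n}) < 4"
  shows "covered n (\<lambda>i. crossing_rim 2 (i mod n)) (\<lambda>i. spokes_2 n (i mod n)) S"
proof (rule covered_crossing_rim)
  fix a :: nat assume "a < 3"
  then have "a = 0 \<or> a = 1 \<or> a = 2" by auto
  then show "2 * a < spokes_2 n (2 * a) \<and> spokes_2 n (2 * a) < 2 * a + 2 \<or> n \<le> spokes_2 n (2 * a)"
    "2 * a < spokes_2 n ((2 * a + 2 + 1) mod n) \<and> spokes_2 n ((2 * a + 2 + 1) mod n) < 2 * a + 2 \<or> n \<le> spokes_2 n ((2 * a + 2 + 1) mod n)"
    "spokes_2 n (2 * a) \<noteq> spokes_2 n ((2 * a + 2 + 1) mod n)"
    using assms(1) by (elim disjE; simp add: spokes_2_def)+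
qed (use assms in \<open>auto simp: spokes_2_def\<close>)

lemma spokes_2_range: "n \<ge> 8 \<Longrightarrow> spokes_2 n ` {..<n} \<subseteq> {..<n + 1} - {4, 6}"
  by (auto simp: spokes_2_def)

text \<open>With \<open>q = 1\<close> the first three windows free nothing. Two new colours separate
  the window ends \<open>0, 2\<close>, then \<open>1, 3\<close>, \<open>2, 4\<close> and
  \<open>3, 1\<close>.\<close>

definition spokes_1 :: "nat \<Rightarrow> nat \<Rightarrow> nat" where
  "spokes_1 n j = (if j \<in> {2, 3} then n + 1 else n)"

lemma covered_spokes_1:
  assumes "n \<ge> 4" "finite S" "card (S - {n}) < 4"
  shows "covered n (\<lambda>i. crossing_rim 1 (i mod n)) (\<lambda>i. spokes_1 n (i mod n)) S"
proof (rule covered_crossing_rim)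
  have "4 mod n \<noteq> 2 \<and> 4 mod n \<noteq> 3"
    using assms(1) by (cases "n = 4") auto
  then show "spokes_1 n (1 * a) \<noteq> spokes_1 n ((1 * a + 1 + 1) mod n)" if "a < 3" for a
  proof -
    have "a = 0 \<or> a = 1 \<or> a = 2" using that by auto
    then show ?thesis
      using assms(1) \<open>4 mod n \<noteq> 2 \<and> 4 mod n \<noteq> 3\<close> by (elim disjE) (simp_all add: spokes_1_def)
  qed
qed (use assms in \<open>auto simp: spokes_1_def\<close>)

lemma spokes_1_range: "n \<ge> 4 \<Longrightarrow> spokes_1 n ` {..<n} \<subseteq> {..<n + 2} - {2, 3}"
  by (auto simp: spokes_1_def)

section \<open>Colourings for four and more vertices\<close>

text \<open>One Hamiltonian cycle serves every set: it omits rim edge 0, whose colour passes to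
  spoke 0, and its other spoke has the new colour \<open>n\<close>.\<close>

lemma covered_hamiltonian:
  assumes n: "n \<ge> 3"
  shows "covered n (\<lambda>i. (\<lambda>j. j) (i mod n)) (\<lambda>i. (\<lambda>j. if j = 0 then 0 else n) (i mod n)) S"
proof -
  have "gap n (\<lambda>i. (\<lambda>j. j) (i mod n)) (\<lambda>i. (\<lambda>j. if j = 0 then 0 else n) (i mod n)) 0 1"
    by (rule gapI_inner) (use n in auto)
  moreover have "avoids n S 0 1" by (auto simp: avoids_def)
  ultimately show ?thesis by (auto simp: covered_def)
qed

text \<open>The rim serves sets without the hub. Otherwise at most \<open>k - 1\<close> rim vertices
  remain for \<open>k\<close> windows; the window from \<open>2 * a\<close> to
  \<open>2 * a + 3\<close> omits the edges \<open>2 * a\<close> and \<open>2 * a + 2\<close>, whose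
  colours are those of its end spokes.\<close>

lemma covered_rainbow_rim:
  assumes k: "k \<ge> 2" "2 * k \<le> n" "n \<ge> 3" and S: "finite S" "card S \<le> k"
  shows "covered n (\<lambda>i. (\<lambda>j. j) (i mod n)) (\<lambda>i. (\<lambda>j. 2 * (j div 2)) (i mod n)) S"
proof (cases "n \<in> S")
  case True
  show ?thesis
  proof (rule covered_by_staircase[where K = k and q = 2])
    fix a assume a: "a + 1 < k"
    have "(2 * a + 3) div 2 = a + 1" by simp
    then show "gap n (\<lambda>i. (\<lambda>j. j) (i mod n)) (\<lambda>i. (\<lambda>j. 2 * (j div 2)) (i mod n)) (2 * a) (2 + 1)"
      by (intro gapI_inner) (use a k in auto)
  next
    show "gap n (\<lambda>i. (\<lambda>j. j) (i mod n)) (\<lambda>i. (\<lambda>j. 2 * (j div 2)) (i mod n))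
      (2 * (k - 1)) (n + 1 - 2 * (k - 1))"
      by (rule gapI_wrap) (use k in auto)
    show "card (S - {n}) < k"
      using S True k by (simp add: card_Diff_singleton)
  qed (use k S in auto)
next
  case False
  then show ?thesis by (simp add: covered_def inj_on_def)
qed

section \<open>Lower bounds\<close>

lemma mod_add_cancel_nat:
  fixes a b g n :: nat
  assumes "(a + g) mod n = (b + g) mod n"
  shows "a mod n = b mod n"
proof -
  have *: "a mod n = b mod n" if "a \<le> b" "(a + g) mod n = (b + g) mod n" for a b :: nat
  proof -
    have "n dvd (b + g) - (a + g)"
      using that mod_eq_dvd_iff_nat[of "a + g" "b + g" n] by simp
    then show ?thesis using that mod_eq_dvd_iff_nat[of a b n] by simp
  qed
  show ?thesis
  proof (cases "a \<le> b")
    case True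
    then show ?thesis using assms by (rule *)
  next
    case False
    then have "b \<le> a" by simp
    then have "b mod n = a mod n" using assms[symmetric] by (rule *)
    then show ?thesis ..
  qed
qed

lemma mod_eqE:
  fixes a b n :: nat
  assumes "a mod n = b mod n"
  obtains k where "a = b + k * n" | k where "b = a + k * n"
proof (cases "a \<le> b")
  case True
  then have "n dvd b - a" using assms mod_eq_dvd_iff_nat[of a b n] by simp
  then obtain k where "b - a = n * k" by (rule dvdE)
  then show ?thesis using that(2)[of k] True by (simp add: mult.commute)
next
  case False
  then have "n dvd a - b" using assms mod_eq_dvd_iff_nat[of b a n] by simp
  then obtain k where "a - b = n * k" by (rule dvdE)
  then show ?thesis using that(1)[of k] False by (simp add: mult.commute)
qed

section \<open>Periodic colourings and their windows\<close>

locale periodic_colouring =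
  fixes n :: nat and r s :: "nat \<Rightarrow> nat"
  assumes n: "n \<ge> 3"
    and r_add [simp]: "r (i + n) = r i"
    and s_add [simp]: "s (i + n) = s i"
begin

definition colours :: "nat set" where
  "colours = r ` {..<n} \<union> s ` {..<n}"

lemma r_add_mult [simp]: "r (i + k * n) = r i"
proof (induction k)
  case (Suc k)
  have "i + Suc k * n = (i + k * n) + n" by simp
  then show ?case using Suc by (metis r_add)
qed simp

lemma s_add_mult [simp]: "s (i + k * n) = s i"
proof (induction k)
  case (Suc k)
  have "i + Suc k * n = (i + k * n) + n" by simp
  then show ?case using Suc by (metis s_add)
qed simp

lemma r_mod: "r (i mod n) = r i"
  using r_add_mult[of "i mod n" "i div n"] by simp

lemma s_mod: "s (i mod n) = s i"
  using s_add_mult[of "i mod n" "i div n"] by simp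

lemma finite_colours: "finite colours"
  by (simp add: colours_def)

lemma r_in_colours: "r i \<in> colours"
proof -
  have "i mod n < n" using n by simp
  then show ?thesis unfolding colours_def using r_mod[of i] by (metis UnI1 imageI lessThan_iff)
qed

lemma s_in_colours: "s i \<in> colours"
proof -
  have "i mod n < n" using n by simp
  then show ?thesis unfolding colours_def using s_mod[of i] by (metis UnI2 imageI lessThan_iff)
qed

lemma gap_add_mult: "gap n r s (l + k * n) g \<longleftrightarrow> gap n r s l g"
proof -
  have A: "{l + k * n + g..<l + k * n + n} = (\<lambda>i. i + k * n) ` {l + g..<l + n}"
    by (simp add: image_add_atLeastLessThan' ac_simps)
  have "inj_on r ((\<lambda>i. i + k * n) ` {l + g..<l + n}) \<longleftrightarrow> inj_on r {l + g..<l + n}"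
    using comp_inj_on_iff[of "\<lambda>i. i + k * n" "{l + g..<l + n}" r] by (simp add: comp_def)
  moreover have "r ` (\<lambda>i. i + k * n) ` {l + g..<l + n} = r ` {l + g..<l + n}"
    unfolding image_image by simp
  moreover have "s (l + k * n + g) = s (l + g)"
    using s_add_mult[of "l + g" k] by (simp add: ac_simps)
  ultimately show ?thesis unfolding gap_def A by simp
qed

lemma avoids_add_mult: "avoids n S (l + k * n) g \<longleftrightarrow> avoids n S l g"
proof
  assume *: "avoids n S (l + k * n) g"
  show "avoids n S l g"
    unfolding avoids_def
  proof (intro allI impI)
    fix x assume "x mod n \<in> S"
    then have "(x + k * n) mod n \<in> S" by simp
    then have "\<not> (l + k * n < x + k * n \<and> x + k * n < l + k * n + g)"
      using * unfolding avoids_def by blast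
    then show "\<not> (l < x \<and> x < l + g)" by simp
  qed
next
  assume *: "avoids n S l g"
  show "avoids n S (l + k * n) g"
    unfolding avoids_def
  proof (intro allI impI notI)
    fix x assume x: "x mod n \<in> S" "l + k * n < x \<and> x < l + k * n + g"
    then have "x = (x - k * n) + k * n" by simp
    then have "(x - k * n) mod n \<in> S" using x(1) by (metis mod_mult_self1)
    then show False using * x(2) unfolding avoids_def by fastforce
  qed
qed

lemma gap_mod_cong: "l mod n = l' mod n \<Longrightarrow> gap n r s l g \<longleftrightarrow> gap n r s l' g"
  by (erule mod_eqE) (simp_all add: gap_add_mult)

lemma avoids_mod_cong: "l mod n = l' mod n \<Longrightarrow> avoids n S l g \<longleftrightarrow> avoids n S l' g"
  by (erule mod_eqE) (simp_all add: avoids_add_mult)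

text \<open>Few colours force long windows: at most \<open>n\<close> colours give
  \<open>g \<ge> 2\<close>, fewer than \<open>n\<close> give \<open>g \<ge> 3\<close>.\<close>

lemma gap_card:
  assumes "gap n r s l g"
  shows "n + 2 \<le> card colours + g"
proof -
  have "card (insert (s l) (insert (s (l + g)) (r ` {l + g..<l + n}))) = n - g + 2"
    using assms by (simp add: gap_def card_image)
  moreover have "card (insert (s l) (insert (s (l + g)) (r ` {l + g..<l + n}))) \<le> card colours"
    by (intro card_mono finite_colours) (auto simp: r_in_colours s_in_colours)
  ultimately show ?thesis using assms by (simp add: gap_def)
qed

lemma inj_rim_card:
  assumes "inj_on r {..<n}"
  shows "n \<le> card colours"
proof -
  have "card (r ` {..<n}) = n" using assms by (simp add: card_image)
  moreover have "card (r ` {..<n}) \<le> card colours"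
    by (intro card_mono finite_colours) (auto simp: colours_def)
  ultimately show ?thesis by simp
qed

text \<open>Normalises the left end of the window to a chosen period, which keeps later case
  distinctions finite.\<close>

lemma coveredE:
  assumes "covered n r s S"
  obtains "inj_on r {..<n}" "n \<notin> S"
    | l g where "x \<le> l" "l < x + n" "gap n r s l g" "avoids n S l g"
  using assms unfolding covered_def
proof (elim disjE exE conjE)
  fix l g assume lg: "gap n r s l g" "avoids n S l g"
  have "l mod n < n" using n by simp
  then obtain l' where l': "x \<le> l'" "l' < x + n" "l' mod n = l mod n"
    using ex_mod_in_period[of "l mod n" n x] by blast
  then show ?thesis
    using that(2)[of l' g] lg gap_mod_cong[OF l'(3)] avoids_mod_cong[OF l'(3)] by blast
qed (use that(1) in blast)

lemma covered_card:
  assumes "covered n r s S"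
  shows "3 \<le> card colours"
  using assms
proof (cases rule: coveredE[where x = 0])
  case 1
  then show ?thesis using inj_rim_card n by simp
next
  case (2 l g)
  then show ?thesis using gap_card[of l g] by (simp add: gap_def)
qed

definition all_covered :: "nat \<Rightarrow> bool" where
  "all_covered k \<longleftrightarrow> (\<forall>S. S \<subseteq> {0..n} \<and> card S = k \<longrightarrow> covered n r s S)"

lemma all_coveredD: "all_covered k \<Longrightarrow> S \<subseteq> {0..n} \<Longrightarrow> card S = k \<Longrightarrow> covered n r s S"
  by (simp add: all_covered_def)

lemma mod_distinct: "x < y \<Longrightarrow> y < x + n \<Longrightarrow> x mod n \<noteq> y mod n"
  using mod_inj_on_period[of x n y x] by auto

lemma mod_in_V: "x mod n \<in> {0..n}"
proof -
  have "x mod n < n" using n by simp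
  then show ?thesis by simp
qed

lemma pair_gap:
  assumes "all_covered 2" "\<not> inj_on r {..<n}" "x < y" "y < x + n"
  obtains l g where "gap n r s l g" "x \<le> l \<and> l + g \<le> y \<or> y \<le> l \<and> l + g \<le> x + n"
proof -
  let ?S = "{x mod n, y mod n}"
  have "card ?S = 2" using mod_distinct[OF assms(3,4)] by simp
  then have "covered n r s ?S"
    by (intro all_coveredD[OF assms(1)] insert_subsetI mod_in_V empty_subsetI)
  then show ?thesis
  proof (cases rule: coveredE[where x = x])
    case (2 l g)
    have "\<not> (l < v \<and> v < l + g)" if "v mod n \<in> ?S" for v
      using 2(4) that unfolding avoids_def by blast
    from this[of y] this[of "x + n"] show ?thesis
      using that[of l g] 2 by auto
  qed (use assms(2) in blast)
qed

text \<open>The window fits into one of the three parts between \<open>x\<close>, \<open>y\<close>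
  and \<open>z\<close>, so the other two parts are jointly rainbow and this part is long.
  Refutations choose the cuts so that each part leaves a repeated pair outside.\<close>

lemma triple_gap:
  assumes "all_covered 3" "\<not> inj_on r {..<n}" "x < y" "y < z" "z < x + n"
  obtains "inj_on r {y..<x + n}" "n + 2 + x \<le> card colours + y"
    | "inj_on r {z..<y + n}" "n + 2 + y \<le> card colours + z"
    | "inj_on r {x + n..<z + n}" "2 + z \<le> card colours + x"
proof -
  let ?S = "{x mod n, y mod n, z mod n}"
  have "card ?S = 3" using mod_distinct[of x y] mod_distinct[of y z] mod_distinct[of x z] assms by simp
  then have "covered n r s ?S"
    by (intro all_coveredD[OF assms(1)] insert_subsetI mod_in_V empty_subsetI)
  then show ?thesis
  proof (cases rule: coveredE[where x = x])
    case (2 l g)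
    have av: "\<not> (l < v \<and> v < l + g)" if "v mod n \<in> ?S" for v
      using 2(4) that unfolding avoids_def by blast
    have av: "\<not> (l < y \<and> y < l + g)" "\<not> (l < z \<and> z < l + g)" "\<not> (l < x + n \<and> x + n < l + g)"
      using av[of y] av[of z] av[of "x + n"] by simp_all
    have inj: "inj_on r A" if "A \<subseteq> {l + g..<l + n}" for A
      using 2(3) that inj_on_subset unfolding gap_def by blast
    have c: "n + 2 \<le> card colours + g" using gap_card 2(3) .
    consider "l < y" | "y \<le> l" "l < z" | "z \<le> l" by linarith
    then show ?thesis
    proof cases
      case 1
      then have "l + g \<le> y" using av by simp
      then show ?thesis using that(1) inj[of "{y..<x + n}"] c 2(1) by auto
    next
      case 2
      then have "l + g \<le> z" using av by simp
      then show ?thesis using that(2) inj[of "{z..<y + n}"] c 2 by auto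
    next
      case 3
      then have "l + g \<le> x + n" using av \<open>l < x + n\<close> by simp
      then show ?thesis using that(3) inj[of "{x + n..<z + n}"] c 3 by auto
    qed
  qed (use assms(2) in blast)
qed

section \<open>Repeated rim colours for three vertices\<close>

lemma not_inj_period:
  assumes "inj_on r A" "x \<in> A" "y \<in> A" "x \<noteq> y" "r x = r y"
  shows False
  using assms by (auto dest: inj_onD)

text \<open>Cutting where the three edges start puts one of them into each part, so two always stay
  outside.\<close>

lemma no_triple_colour:
  assumes "all_covered 3" "\<not> inj_on r {..<n}"
    and "i < j" "j < k" "k < i + n" "r i = r j" "r j = r k"
  shows False
proof (rule triple_gap[OF assms(1,2), of j k "i + n"])
  assume "inj_on r {k..<j + n}"
  then show False by (rule not_inj_period[of _ k "i + n"]) (use assms in auto)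
next
  assume "inj_on r {i + n..<k + n}"
  then show False by (rule not_inj_period[of _ "i + n" "j + n"]) (use assms in auto)
next
  assume "inj_on r {j + n..<i + n + n}"
  then show False by (rule not_inj_period[of _ "j + n" "k + n"]) (use assms in auto)
qed (use assms in auto)

text \<open>With cuts at \<open>b\<close>, \<open>b'\<close> and \<open>a\<close>, only the part
  from \<open>a\<close> to \<open>b\<close> contains edges of the first pair, and it contains none
  of the second.\<close>

lemma no_parallel_pairs:
  assumes "all_covered 3" "\<not> inj_on r {..<n}"
    and "a < a'" "a' < b" "b < b'" "b' < a + n" "r a = r a'" "r b = r b'"
  shows False
proof (rule triple_gap[OF assms(1,2), of b b' "a + n"])
  assume "inj_on r {b'..<b + n}"
  then show False by (rule not_inj_period[of _ "a + n" "a' + n"]) (use assms in auto)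
next
  assume "inj_on r {a + n..<b' + n}"
  then show False by (rule not_inj_period[of _ "a + n" "a' + n"]) (use assms in auto)
next
  assume "inj_on r {b + n..<a + n + n}"
  then show False by (rule not_inj_period[of _ "b + n" "b' + n"]) (use assms in auto)
qed (use assms in auto)

text \<open>With cuts at \<open>a\<close>, \<open>c\<close> and \<open>b'\<close>, the three parts
  miss the pairs of \<open>c\<close>, of \<open>b\<close> and of \<open>a\<close>
  respectively.\<close>

lemma no_three_crossing_pairs:
  assumes "all_covered 3" "\<not> inj_on r {..<n}"
    and "a < b" "b < c" "c < a'" "a' < b'" "b' < c'" "c' < a + n" "r a = r a'" "r b = r b'" "r c = r c'"
  shows False
proof (rule triple_gap[OF assms(1,2), of a c b'])
  assume "inj_on r {c..<a + n}"
  then show False by (rule not_inj_period[of _ c c']) (use assms in auto)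
next
  assume "inj_on r {b'..<c + n}"
  then show False by (rule not_inj_period[of _ b' "b + n"]) (use assms in auto)
next
  assume "inj_on r {a + n..<b' + n}"
  then show False by (rule not_inj_period[of _ "a + n" "a' + n"]) (use assms in auto)
qed (use assms in auto)

text \<open>With cuts at \<open>a\<close>, \<open>b + 1\<close> and \<open>b'\<close>, only the part
  from \<open>a\<close> to \<open>b + 1\<close> meets both pairs, so the window lies there and this
  part is long.\<close>

lemma crossing_pairs_card:
  assumes "all_covered 3" "\<not> inj_on r {..<n}"
    and "a < b" "b < a'" "a' < b'" "b' < a + n" "r a = r a'" "r b = r b'"
  shows "n + 1 + a \<le> card colours + b"
proof (rule triple_gap[OF assms(1,2), of a "b + 1" b'])
  assume "inj_on r {b'..<b + 1 + n}"
  then have False by (rule not_inj_period[of _ b' "b + n"]) (use assms in auto)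
  then show ?thesis ..
next
  assume "inj_on r {a + n..<b' + n}"
  then have False by (rule not_inj_period[of _ "a + n" "a' + n"]) (use assms in auto)
  then show ?thesis ..
qed (use assms in auto)

text \<open>Its size is the number of colours by which the rim falls short of being rainbow.\<close>

definition repeats :: "nat set" where
  "repeats = {j. j < n \<and> (\<exists>p<j. r p = r j)}"

lemma card_rim_colours: "card (r ` {..<n}) + card repeats = n"
proof -
  have sub: "repeats \<subseteq> {..<n}" by (auto simp: repeats_def)
  have "r j \<in> r ` ({..<n} - repeats)" if "j < n" for j
    using that
  proof (induction j rule: less_induct)
    case (less j)
    show ?case
    proof (cases "j \<in> repeats")
      case True
      then obtain p where "p < j" "r p = r j" by (auto simp: repeats_def)
      then show ?thesis using less.IH[of p] less.prems by simp
    qed (use less.prems in auto)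
  qed
  then have "r ` {..<n} = r ` ({..<n} - repeats)" by auto
  moreover have "inj_on r ({..<n} - repeats)"
    by (rule linorder_inj_onI') (auto simp: repeats_def)
  ultimately have "card (r ` {..<n}) = card ({..<n} - repeats)"
    by (simp add: card_image)
  then show ?thesis using sub card_mono[OF _ sub] by (simp add: card_Diff_subset finite_subset)
qed

lemma repeats_cross:
  assumes "all_covered 3" "\<not> inj_on r {..<n}"
    and "j1 < j2" "j2 < n" "p1 < j1" "p2 < j2" "r p1 = r j1" "r p2 = r j2"
  shows "p1 < p2 \<and> p2 < j1"
proof (rule ccontr)
  assume "\<not> (p1 < p2 \<and> p2 < j1)"
  then consider "p1 = p2" | "p2 = j1" | "j1 < p2" | "p2 < p1" by linarith
  then show False
  proof cases
    case 1
    then show ?thesis using no_triple_colour[OF assms(1,2), of p1 j1 j2] assms by auto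
  next
    case 2
    then show ?thesis using no_triple_colour[OF assms(1,2), of p1 j1 j2] assms by auto
  next
    case 3
    then show ?thesis using no_parallel_pairs[OF assms(1,2), of p1 j1 p2 j2] assms by auto
  next
    \<comment> \<open>Nested pairs become parallel when \<open>p2\<close> moves forward by a
      period.\<close>
    case 4
    then show ?thesis using no_parallel_pairs[OF assms(1,2), of p1 j1 j2 "p2 + n"] assms by auto
  qed
qed

lemma card_repeats_le:
  assumes "all_covered 3" "\<not> inj_on r {..<n}"
  shows "card repeats \<le> 2"
proof (rule ccontr)
  assume "\<not> card repeats \<le> 2"
  then obtain T where T: "T \<subseteq> repeats" "card T = 3"
    using obtain_subset_with_card_n[of 3 repeats] by auto
  then obtain x y z where xyz: "T = {x, y, z}" "x \<noteq> y" "y \<noteq> z" "x \<noteq> z"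
    by (auto simp: card_3_iff)
  have False if j: "j1 < j2" "j2 < j3" "j1 \<in> repeats" "j2 \<in> repeats" "j3 \<in> repeats" for j1 j2 j3
  proof -
    obtain p1 p2 p3 where p: "p1 < j1" "p2 < j2" "p3 < j3" "r p1 = r j1" "r p2 = r j2" "r p3 = r j3"
      and lt: "j3 < n"
      using j by (auto simp: repeats_def)
    have "p1 < p2" "p2 < j1" "p2 < p3" "p3 < j2" "p3 < j1"
      using repeats_cross[OF assms, of j1 j2 p1 p2] repeats_cross[OF assms, of j2 j3 p2 p3]
        repeats_cross[OF assms, of j1 j3 p1 p3] j p lt by auto
    then show False
      using no_three_crossing_pairs[OF assms, of p1 p2 p3 j1 j2 j3] j p lt by auto
  qed
  then show False
    using xyz T(1) by (metis insert_subset linorder_neqE_nat)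
qed

text \<open>Fewer than \<open>n\<close> colours need a window of three edges, but three vertices can
  cut up to six rim edges into parts of at most two.\<close>

lemma one_repeat_large:
  assumes "all_covered 3" "\<not> inj_on r {..<n}"
    and p: "p < j" "j < n" "r p = r j" and few: "card colours < n"
  shows "8 \<le> n"
proof (rule ccontr)
  assume small: "\<not> 8 \<le> n"
  have narrow: "\<exists>a b. (a, b) \<in> {(x, y), (y, z), (z, x + n)} \<and> a + 3 \<le> b \<and> inj_on r {b..<a + n}"
    if "x < y" "y < z" "z < x + n" for x y z
    by (rule triple_gap[OF assms(1,2) that]) (use few that in force)+
  consider "n \<le> 4" | "n = 5 \<or> n = 6" | "n = 7" using small by linarith
  then show False
  proof cases
    case 1
    then show ?thesis using narrow[of 0 1 2] n by auto
  next
    case 2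
    then show ?thesis using narrow[of 0 2 4] n by auto
  next
    case 3
    \<comment> \<open>Seven edges are cut into parts of three, two and two. One of the arcs between
      \<open>p\<close> and \<open>j\<close> leaves room for the three-edge part strictly between
      these two edges, which then both stay outside.\<close>
    show ?thesis
    proof (cases "p + 4 \<le> j")
      case True
      then have "inj_on r {p + 4..<p + 1 + n}" using narrow[of "p + 1" "p + 4" "p + 6"] 3 by auto
      then show False by (rule not_inj_period[of _ "p + n" j]) (use True p 3 r_add[of p] in auto)
    next
      case False
      then have "inj_on r {j + 4..<j + 1 + n}" using narrow[of "j + 1" "j + 4" "j + 6"] 3 by auto
      then show False by (rule not_inj_period[of _ "j + n" "p + n"]) (use False p 3 r_add[of p] r_add[of j] in auto)
    qed
  qed
qed

lemma triples_lower_bound: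
  assumes "all_covered 3"
  shows "n \<le> card colours \<or> n \<le> card colours + 1 \<and> 8 \<le> n \<or> n \<le> card colours + 2 \<and> 12 \<le> n"
proof (cases "inj_on r {..<n}")
  case True
  then show ?thesis using inj_rim_card by simp
next
  case False
  have "card (r ` {..<n}) \<le> card colours" by (intro card_mono finite_colours) (auto simp: colours_def)
  then have le: "n \<le> card colours + card repeats" using card_rim_colours by linarith
  consider "card repeats = 0" | "card repeats = 1" | "card repeats = 2"
    using card_repeats_le[OF assms False] by linarith
  then show ?thesis
  proof cases
    case 2
    then obtain j where "j \<in> repeats" by (auto simp: card_1_singleton_iff)
    then obtain p where "p < j" "j < n" "r p = r j" by (auto simp: repeats_def)
    then show ?thesis using one_repeat_large[OF assms False, of p j] le 2 by linarith
  next
    case 3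
    then obtain j1 j2 where "j1 \<in> repeats" "j2 \<in> repeats" "j1 < j2"
      by (auto simp: card_2_iff) (metis insertCI linorder_neqE_nat)
    then obtain p1 p2 where p: "p1 < j1" "p2 < j2" "r p1 = r j1" "r p2 = r j2" and j: "j1 < j2" "j2 < n"
      by (auto simp: repeats_def)
    have "p1 < p2" "p2 < j1"
      using repeats_cross[OF assms False, of j1 j2 p1 p2] p j by auto
    \<comment> \<open>The four inequalities around the rim add up to
      \<open>4 * (n + 1) \<le> 4 * card colours + n\<close>. With
      \<open>n \<le> card colours + 2\<close> this gives the thresholds 8 and 12.\<close>
    then have "n + 1 + p1 \<le> card colours + p2" "n + 1 + p2 \<le> card colours + j1" "n + 1 + j1 \<le> card colours + j2"
      "n + 1 + j2 \<le> card colours + (p1 + n)"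
      using crossing_pairs_card[OF assms False, of p1 p2 j1 j2]
        crossing_pairs_card[OF assms False, of p2 j1 j2 "p1 + n"]
        crossing_pairs_card[OF assms False, of j1 j2 "p1 + n" "p2 + n"]
        crossing_pairs_card[OF assms False, of j2 "p1 + n" "p2 + n" "j1 + n"] p j by auto
    then show ?thesis using le 3 by linarith
  qed (use le in simp)
qed

section \<open>Lower bound for two vertices\<close>

text \<open>Counting on one pair only yields \<open>h + 2\<close>. With no more colours than that,
  each hub cycle over \<open>h\<close> consecutive rim edges would be rainbow and use all colours;
  comparing shifted cycles refutes this.\<close>

lemma pairs_lower_bound_odd:
  assumes cov: "all_covered 2" and ninj: "\<not> inj_on r {..<n}" and h: "n = 2 * h + 1" "h \<ge> 2"
  shows "h + 3 \<le> card colours"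
proof (rule ccontr)
  assume "\<not> h + 3 \<le> card colours"
  then have few: "card colours \<le> h + 2" by simp
  have gap: "gap n r s (i + h) (h + 1)" for i
  proof -
    obtain l g where lg: "gap n r s l g" "i \<le> l \<and> l + g \<le> i + h \<or> i + h \<le> l \<and> l + g \<le> i + n"
      by (rule pair_gap[OF cov ninj, of i "i + h"]) (use h in auto)
    \<comment> \<open>The window has at least \<open>h + 1\<close> edges, so it is the whole longer
      arc.\<close>
    have "n \<le> h + g" using gap_card[OF lg(1)] few by linarith
    then have "l = i + h" "g = h + 1" using lg(2) h by linarith+
    then show ?thesis using lg(1) by simp
  qed
  have arc: "i + h + (h + 1) = i + n" for i using h by simp
  have A: "x = y" if "i \<le> x" "x < i + h" "i \<le> y" "y < i + h" "r x = r y" for i x y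
  proof -
    have "inj_on r {i + n..<i + h + n}" using gap[of i] by (simp only: gap_def arc)
    then have "x + n = y + n" by (rule inj_onD) (use that in auto)
    then show ?thesis by simp
  qed
  have B: "s i \<noteq> s (i + h)" for i
    using gap[of i] unfolding gap_def arc by auto
  have notin: "s (i + h) \<notin> r ` {i + n..<i + h + n}" "s i \<notin> r ` {i + n..<i + h + n}" for i
    using gap[of i] unfolding gap_def arc by auto
  have left: "s i \<noteq> r e" and right: "s (i + h) \<noteq> r e" if "i \<le> e" "e < i + h" for i e
  proof -
    have "r e \<in> r ` {i + n..<i + h + n}"
      using that by (intro image_eqI[of _ _ "e + n"]) auto
    then show "s i \<noteq> r e" "s (i + h) \<noteq> r e" using notin[of i] by metis+
  qed
  \<comment> \<open>The cycle over the arc from \<open>i\<close> shows \<open>h + 2\<close> distinct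
    colours, hence all of them; any colour can be looked up in each such cycle.\<close>
  have E: "v = s i \<or> v = s (i + h) \<or> (\<exists>e. i \<le> e \<and> e < i + h \<and> v = r e)" if "v \<in> colours" for v i
  proof -
    let ?T = "insert (s i) (insert (s (i + h)) (r ` {i..<i + h}))"
    have "inj_on r {i..<i + h}" by (rule inj_onI) (use A in auto)
    moreover have "s i \<notin> r ` {i..<i + h}" "s (i + h) \<notin> r ` {i..<i + h}"
      using left right by auto
    ultimately have "card ?T = h + 2" using B[of i] by (simp add: card_image)
    moreover have "?T \<subseteq> colours" using r_in_colours s_in_colours by auto
    ultimately have "?T = colours" using card_seteq[OF finite_colours] few by metis
    then have "v \<in> ?T" using that by simp
    then show ?thesis by auto
  qed
  \<comment> \<open>If \<open>r\<close> had period \<open>h\<close>, then edges 0 and 1 would agree,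
    because \<open>n = 2 * h + 1\<close>.\<close>
  have "\<exists>i. r i \<noteq> r (i + h)"
  proof (rule ccontr)
    assume "\<not> (\<exists>i. r i \<noteq> r (i + h))"
    then have "r 1 = r (1 + h)" "r (1 + h) = r (1 + h + h)" by blast+
    moreover have "1 + h + h = 0 + n" using h by simp
    ultimately have "r 1 = r 0" by (metis r_add)
    then show False using A[of 0 1 0] h by simp
  qed
  then obtain i where i: "r i \<noteq> r (i + h)" by blast
  \<comment> \<open>The colour of edge \<open>i + h\<close> occurs in the cycle from
    \<open>i\<close>, and only the spoke at \<open>i\<close> is left for it.\<close>
  have si: "s i = r (i + h)"
  proof -
    have "r (i + h) \<noteq> s (i + h)" using left[of "i + h" "i + h"] h by auto
    moreover have "r (i + h) \<noteq> r e" if "i \<le> e" "e < i + h" for e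
      using A[of "i + 1" e "i + h"] i that by (cases "e = i") auto
    ultimately show ?thesis using E[OF r_in_colours[of "i + h"], of i] by auto
  qed
  have shift: "i + h + 2 + h = i + 1 + n" "i + h + 1 + h = i + n" using h by simp_all
  have s1: "s (i + 1) \<noteq> r e" if "i + h + 2 \<le> e" "e < i + 1 + n" for e
    using right[of "i + h + 2" e] that s_add[of "i + 1"] unfolding shift by auto
  \<comment> \<open>Symmetrically, the colour of edge \<open>i\<close> is looked up in the cycle
    from \<open>i + 1\<close>.\<close>
  have sh1: "s (i + 1 + h) = r i"
  proof -
    have "s (i + 1) \<noteq> r (i + n)" by (rule s1) (use h in auto)
    then have "r i \<noteq> s (i + 1)" by (metis r_add)
    moreover have "r i \<noteq> r e" if "i + 1 \<le> e" "e < i + 1 + h" for e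
      using A[of i i e] i that by (cases "e = i + h") auto
    ultimately show ?thesis using E[OF r_in_colours[of i], of "i + 1"] by auto
  qed
  have ri: "s (i + h) \<noteq> r i" using right[of i i] h by simp
  \<comment> \<open>In the cycle from \<open>i + 1\<close>, only the spoke at \<open>i + 1\<close>
    can carry the colour of the spoke at \<open>i + h\<close>.\<close>
  have sh: "s (i + h) = s (i + 1)"
  proof -
    have "s (i + h) \<noteq> r e" if "i + 1 \<le> e" "e < i + 1 + h" for e
      using right[of i e] left[of "i + h" e] that h by (cases "e = i + h") auto
    then show ?thesis using E[OF s_in_colours[of "i + h"], of "i + 1"] sh1 ri by auto
  qed
  \<comment> \<open>This colour is now absent from the cycle over the arc from
    \<open>i + h + 1\<close> to \<open>i + n\<close>.\<close>
  have "s (i + h) \<noteq> s (i + h + 1)" using sh1 ri by (simp add: ac_simps)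
  moreover have "s (i + h) \<noteq> s (i + h + 1 + h)" unfolding shift using B[of i] by simp
  moreover have "s (i + h) \<noteq> r e" if "i + h + 1 \<le> e" "e < i + h + 1 + h" for e
  proof (cases "e = i + h + h")
    case True
    then show ?thesis using s1[of e] sh h by simp
  next
    case False
    then show ?thesis using left[of "i + h" e] that by simp
  qed
  ultimately show False using E[OF s_in_colours[of "i + h"], of "i + h + 1"] by blast
qed

lemma pairs_lower_bound:
  assumes cov: "all_covered 2" and n4: "n \<ge> 4"
  shows "(n + 1) div 2 + 2 \<le> card colours"
proof (cases "inj_on r {..<n}")
  case True
  then show ?thesis using inj_rim_card n4 by linarith
next
  case False
  show ?thesis
  proof (cases "even n")
    case True
    then obtain h where h: "n = 2 * h" by (rule evenE)
    obtain l g where lg: "gap n r s l g" "0 \<le> l \<and> l + g \<le> h \<or> h \<le> l \<and> l + g \<le> 0 + n"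
      by (rule pair_gap[OF cov False, of 0 h]) (use h n4 in auto)
    then show ?thesis using gap_card[OF lg(1)] h by linarith
  next
    case odd: False
    then obtain h where h: "n = 2 * h + 1" by (rule oddE)
    then show ?thesis using pairs_lower_bound_odd[OF cov False h] n4 by simp
  qed
qed

section \<open>Lower bound for four and more vertices\<close>

text \<open>If two rim edges share a colour, putting their ends into \<open>S\<close> keeps both
  edges out of every window of at least two edges, and at most \<open>n\<close> colours rule out
  windows of one edge.\<close>

lemma rainbow_rim_or_many:
  assumes cov: "all_covered k" and k: "4 \<le> k" "k \<le> n" and few: "card colours \<le> n"
  shows "inj_on r {..<n}"
proof (rule ccontr)
  assume ninj: "\<not> inj_on r {..<n}"
  then obtain a a' where a: "a < a'" "a' < n" "r a = r a'"
    unfolding inj_on_def by (metis lessThan_iff linorder_neqE_nat)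
  let ?S = "{a mod n, (a + 1) mod n, a' mod n, (a' + 1) mod n}"
  have "?S \<subseteq> {..<n}" using n by auto
  moreover have "card ?S \<le> k" using k(1) by (intro order_trans[OF card_insert_le_m1]) (auto intro!: card_insert_le_m1)
  ultimately obtain S where S: "?S \<subseteq> S" "S \<subseteq> {..<n}" "card S = k"
    using exists_subset_between[of ?S k "{..<n}"] k(2) by auto
  have "covered n r s S"
    by (rule all_coveredD[OF cov _ S(3)]) (use S(2) in auto)
  then show False
  proof (cases rule: coveredE[where x = a])
    case (2 l g)
    have av: "\<not> (l < v \<and> v < l + g)" if "v mod n \<in> ?S" for v
      using 2(4) that S(1) unfolding avoids_def by blast
    have av: "\<not> (l < a + 1 \<and> a + 1 < l + g)" "\<not> (l < a' \<and> a' < l + g)"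
      "\<not> (l < a' + 1 \<and> a' + 1 < l + g)" "\<not> (l < a + n \<and> a + n < l + g)"
      using av[of "a + 1"] av[of a'] av[of "a' + 1"] av[of "a + n"] by simp_all
    have g: "2 \<le> g" "g < n" using gap_card[OF 2(3)] few 2(3) by (auto simp: gap_def)
    have inj: "inj_on r {l + g..<l + n}" using 2(3) by (simp add: gap_def)
    consider "l = a" | "a < l" "l < a'" | "l = a'" | "a' < l" using 2(1) by linarith
    then show False
    proof cases
      case 1
      then show ?thesis using av(1) g by simp
    next
      case 2
      then show ?thesis using av(2) not_inj_period[OF inj, of a' "a + n"] a by auto
    next
      case 3
      then show ?thesis using av(3) g by simp
    next
      case 4
      then show ?thesis using av(4) \<open>l < a + n\<close> not_inj_period[OF inj, of "a + n" "a' + n"] a by auto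
    qed
  qed (use ninj in blast)
qed

lemma all_vertices_lower_bound:
  assumes "all_covered (n + 1)"
  shows "n + 1 \<le> card colours"
proof -
  have "covered n r s {0..n}" by (rule all_coveredD[OF assms]) auto
  then show ?thesis
  proof (cases rule: coveredE[where x = 0])
    case (2 l g)
    have "\<not> (l < l + 1 \<and> l + 1 < l + g)"
      using 2(4) mod_in_V[of "l + 1"] unfolding avoids_def by blast
    then show ?thesis using gap_card[OF 2(3)] 2(3) by (simp add: gap_def)
  qed auto
qed

text \<open>Windows minimal under inclusion: it suffices to hit their interiors, and there are few
  of them.\<close>

definition minimal_gap :: "nat \<Rightarrow> nat \<Rightarrow> bool" where
  "minimal_gap l g \<longleftrightarrow> gap n r s l g \<and>
     (\<forall>l' g'. gap n r s l' g' \<and> l \<le> l' \<and> l' + g' \<le> l + g \<longrightarrow> l' = l \<and> g' = g)"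

lemma ex_minimal_gap:
  assumes "gap n r s l g"
  shows "\<exists>l' g'. minimal_gap l' g' \<and> l \<le> l' \<and> l' + g' \<le> l + g"
  using assms
proof (induction g arbitrary: l rule: less_induct)
  case (less g)
  show ?case
  proof (cases "minimal_gap l g")
    case False
    then obtain l' g' where lg: "gap n r s l' g'" "l \<le> l'" "l' + g' \<le> l + g" "\<not> (l' = l \<and> g' = g)"
      using less.prems by (auto simp: minimal_gap_def)
    then have "g' < g" by linarith
    then obtain l'' g'' where "minimal_gap l'' g''" "l' \<le> l''" "l'' + g'' \<le> l' + g'"
      using less.IH lg(1) by blast
    then show ?thesis using lg by (meson le_trans)
  qed auto
qed

lemma minimal_gap_add_mult: "minimal_gap (l + k * n) g \<longleftrightarrow> minimal_gap l g"
proof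
  assume m: "minimal_gap (l + k * n) g"
  have "l' = l \<and> g' = g" if "gap n r s l' g'" "l \<le> l'" "l' + g' \<le> l + g" for l' g'
  proof -
    have "gap n r s (l' + k * n) g'" using that(1) by (simp add: gap_add_mult)
    moreover have "l + k * n \<le> l' + k * n" "l' + k * n + g' \<le> l + k * n + g" using that by auto
    ultimately have "l' + k * n = l + k * n \<and> g' = g" using m unfolding minimal_gap_def by blast
    then show ?thesis by simp
  qed
  moreover have "gap n r s l g" using m by (simp add: minimal_gap_def gap_add_mult)
  ultimately show "minimal_gap l g" unfolding minimal_gap_def by blast
next
  assume m: "minimal_gap l g"
  have "l' = l + k * n \<and> g' = g"
    if inner: "gap n r s l' g'" "l + k * n \<le> l'" "l' + g' \<le> l + k * n + g" for l' g'
  proof -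
    define l0 where "l0 = l' - k * n"
    have l0: "l' = l0 + k * n" using inner(2) by (simp add: l0_def)
    have "gap n r s l0 g'" "l \<le> l0" "l0 + g' \<le> l + g"
      using inner unfolding l0 by (simp_all add: gap_add_mult)
    then have "l0 = l \<and> g' = g" using m unfolding minimal_gap_def by blast
    then show ?thesis by (simp add: l0)
  qed
  moreover have "gap n r s (l + k * n) g" using m by (simp add: minimal_gap_def gap_add_mult)
  ultimately show "minimal_gap (l + k * n) g" unfolding minimal_gap_def by blast
qed

lemma minimal_gap_mod_cong: "l mod n = l' mod n \<Longrightarrow> minimal_gap l g \<longleftrightarrow> minimal_gap l' g"
  by (erule mod_eqE) (simp_all add: minimal_gap_add_mult)

text \<open>Windows with a common right end are nested.\<close>

lemma minimal_gap_right_unique: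
  assumes "minimal_gap l g" "minimal_gap l' g'" "(l + g) mod n = (l' + g') mod n"
  shows "l mod n = l' mod n \<and> g = g'"
proof -
  have *: "l mod n = l' mod n \<and> g = g'"
    if "minimal_gap l g" "minimal_gap l' g'" "(l + g) mod n = (l' + g') mod n" "g \<le> g'" for l g l' g'
  proof -
    define l0 where "l0 = l' + (g' - g)"
    have "(l0 + g) mod n = (l + g) mod n" using that by (simp add: l0_def)
    then have "l0 mod n = l mod n" by (rule mod_add_cancel_nat)
    then have "gap n r s l0 g" using that(1) gap_mod_cong unfolding minimal_gap_def by blast
    then have "l0 = l' \<and> g = g'"
      using that(2,4) unfolding minimal_gap_def l0_def by fastforce
    then show ?thesis using \<open>l0 mod n = l mod n\<close> by simp
  qed
  show ?thesis
  proof (cases "g \<le> g'")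
    case True
    then show ?thesis by (rule *[OF assms])
  next
    case False
    then show ?thesis using *[OF assms(2,1) assms(3)[symmetric]] by simp
  qed
qed

text \<open>If spokes bring no new colours, an end spoke of a rainbow hub cycle must repeat the
  colour of an omitted edge.\<close>

lemma gap_spoke_edges:
  assumes few: "s ` {..<n} \<subseteq> r ` {..<n}" and gap: "gap n r s l g"
  obtains e where "l \<le> e" "e < l + g" "s l = r e"
    and "\<exists>e. l \<le> e \<and> e < l + g \<and> s (l + g) = r e"
proof -
  have *: "\<exists>e. l \<le> e \<and> e < l + g \<and> s x = r e" if "s x \<notin> r ` {l + g..<l + n}" for x
  proof -
    have "x mod n < n" using n by simp
    then have "s (x mod n) \<in> r ` {..<n}" using few by auto
    then obtain e0 where "e0 < n" "s x = r e0" by (auto simp: s_mod)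
    then obtain e where e: "l \<le> e" "e < l + n" "e mod n = e0"
      using ex_mod_in_period[of e0 n l] by blast
    then have "s x = r e" using r_mod[of e] \<open>s x = r e0\<close> by simp
    then show ?thesis using that e by (cases "e < l + g") auto
  qed
  from gap *[of l] *[of "l + g"] that show ?thesis unfolding gap_def by blast
qed

text \<open>The end spokes of a minimal gap repeat rim colours inside it. Hence a vertex that is both a left
  end and a right end of minimal gaps forces these two gaps to overlap on the far side, and then three
  vertices meet all gaps; otherwise the ends of the minimal gaps are distinct vertices, so there are at
  most \<open>n div 2\<close> minimal gaps.\<close>

lemma gap_hitting_set:
  assumes inj: "inj_on r {..<n}" and few: "card colours \<le> n" and m: "3 \<le> m" "n \<le> 2 * m + 1"
  shows "\<exists>H\<subseteq>{..<n}. card H \<le> m \<and> (\<forall>l g. gap n r s l g \<longrightarrow> \<not> avoids n H l g)"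
proof -
  \<comment> \<open>A rainbow rim already exhausts the palette.\<close>
  have "r ` {..<n} = colours"
  proof (rule card_seteq[OF finite_colours])
    show "card colours \<le> card (r ` {..<n})" using few by (simp add: card_image[OF inj])
  qed (simp add: colours_def)
  then have sub: "s ` {..<n} \<subseteq> r ` {..<n}" by (auto simp: colours_def)
  have r_inj: "x = y" if "r x = r y" "a \<le> x" "x < a + n" "a \<le> y" "y < a + n" for x y a
  proof (rule mod_inj_on_period[OF _ that(2-)])
    have "x mod n < n" "y mod n < n" using n by auto
    then show "x mod n = y mod n" using inj_onD[OF inj, of "x mod n" "y mod n"] that(1) by (simp add: r_mod)
  qed
  have g2: "2 \<le> g \<and> g < n" if "gap n r s l g" for l g
    using gap_card[OF that] few that by (auto simp: gap_def)
  define M where "M = {(l, g). l < n \<and> minimal_gap l g}"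
  have M_sub: "M \<subseteq> {..<n} \<times> {..<n}"
    using g2 by (auto simp: M_def minimal_gap_def)
  then have finM: "finite M" by (rule finite_subset) auto
  show ?thesis
  proof (cases "\<exists>(i, g)\<in>M. \<exists>(l', g')\<in>M. (l' + g') mod n = i")
    case False
    \<comment> \<open>The first interior vertex of each minimal window; it exists since
      \<open>g \<ge> 2\<close>.\<close>
    let ?H = "(\<lambda>(l, g). (l + 1) mod n) ` M"
    have "inj_on fst M"
    proof (rule inj_onI, clarsimp)
      fix l g g' assume "(l, g) \<in> M" "(l, g') \<in> M"
      then have "minimal_gap l g" "minimal_gap l g'" by (auto simp: M_def)
      then show "g = g'"
        unfolding minimal_gap_def by (metis le_cases add_le_mono order_refl)
    qed
    then have "card (fst ` M) = card M" by (rule card_image)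
    moreover have "inj_on (\<lambda>(l, g). (l + g) mod n) M"
    proof (rule inj_onI, clarsimp)
      fix l g l' g' assume *: "(l, g) \<in> M" "(l', g') \<in> M" "(l + g) mod n = (l' + g') mod n"
      then have "l mod n = l' mod n \<and> g = g'"
        by (intro minimal_gap_right_unique) (auto simp: M_def)
      then show "l = l' \<and> g = g'" using * by (auto simp: M_def)
    qed
    then have "card ((\<lambda>(l, g). (l + g) mod n) ` M) = card M" by (rule card_image)
    \<comment> \<open>No vertex is both a left and a right end here. Either end determines its
      minimal window, so \<open>2 * card M \<le> n\<close>.\<close>
    moreover have "fst ` M \<inter> (\<lambda>(l, g). (l + g) mod n) ` M = {}" using False by fastforce
    then have "card (fst ` M \<union> (\<lambda>(l, g). (l + g) mod n) ` M)
        = card (fst ` M) + card ((\<lambda>(l, g). (l + g) mod n) ` M)"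
      using finM by (intro card_Un_disjoint) auto
    moreover have "card (fst ` M \<union> (\<lambda>(l, g). (l + g) mod n) ` M) \<le> card {..<n}"
      by (intro card_mono) (use n in \<open>auto simp: M_def\<close>)
    ultimately have "2 * card M \<le> n" by simp
    then have "card ?H \<le> m" using card_image_le[OF finM, of "\<lambda>(l, g). (l + 1) mod n"] m by linarith
    moreover have "?H \<subseteq> {..<n}" using n by auto
    moreover have "\<not> avoids n ?H l g" if gap: "gap n r s l g" for l g
    proof -
      obtain l' g' where lg: "minimal_gap l' g'" "l \<le> l'" "l' + g' \<le> l + g"
        using ex_minimal_gap[OF gap] by blast
      have "minimal_gap (l' mod n) g'" using lg(1) minimal_gap_mod_cong[of "l' mod n" l' g'] by simp
      then have "(l' mod n, g') \<in> M" using n by (simp add: M_def)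
      then have "(l' + 1) mod n \<in> ?H"
        by (intro image_eqI[of _ _ "(l' mod n, g')"]) (auto simp: mod_Suc_eq)
      moreover have "2 \<le> g'" using g2 lg(1) by (auto simp: minimal_gap_def)
      then have "l < l' + 1 \<and> l' + 1 < l + g" using lg by linarith
      ultimately show ?thesis unfolding avoids_def by blast
    qed
    ultimately show ?thesis by blast
  next
    case True
    then obtain i g l' g' where ig: "minimal_gap i g" and lg': "minimal_gap l' g'" "(l' + g') mod n = i"
      by (auto simp: M_def)
    define j where "j = i + g"
    \<comment> \<open>The window that ends at \<open>i\<close> is moved to end at
      \<open>i + n\<close>; \<open>j'\<close> is its left end.\<close>
    define j' where "j' = i + n - g'"
    have b: "2 \<le> g" "g < n" "2 \<le> g'" "g' < n"
      using g2 ig lg'(1) by (auto simp: minimal_gap_def)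
    have "(j' + g') mod n = (l' + g') mod n" using b lg'(2) by (auto simp: j'_def)
    then have "j' mod n = l' mod n" by (rule mod_add_cancel_nat)
    then have jm: "minimal_gap j' g'" using lg'(1) minimal_gap_mod_cong by blast
    have jg: "j' + g' = i + n" using b by (simp add: j'_def)
    obtain e where e: "i \<le> e" "e < i + g" "s i = r e"
      using gap_spoke_edges[OF sub] ig unfolding minimal_gap_def by metis
    obtain e' where e': "j' \<le> e'" "e' < j' + g'" "s (j' + g') = r e'"
      using gap_spoke_edges[OF sub] jm unfolding minimal_gap_def by metis
    \<comment> \<open>The spoke at \<open>i\<close> ends both windows, and on a rainbow rim its
      colour sits on a single edge. This edge lies in both windows, whence
      \<open>j' < j\<close>.\<close>
    have "e = e'"
      by (rule r_inj[of _ _ i]) (use e e' b jg in \<open>auto simp: j'_def\<close>)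
    then have ord: "i < j'" "j' < j" "j < i + n" using e e' b by (auto simp: j_def j'_def)
    let ?H = "{i mod n, j' mod n, j mod n}"
    have "card ?H \<le> 3" by (intro order_trans[OF card_insert_le_m1]) (auto intro!: card_insert_le_m1)
    then have "card ?H \<le> m" using m by simp
    moreover have "?H \<subseteq> {..<n}" using n by auto
    moreover have "\<not> avoids n ?H l0 g0" if gap0: "gap n r s l0 g0" for l0 g0
    proof
      assume av0: "avoids n ?H l0 g0"
      have "l0 mod n < n" using n by simp
      then obtain l where l: "i \<le> l" "l < i + n" "l mod n = l0 mod n"
        using ex_mod_in_period[of "l0 mod n" n i] by blast
      have gl: "gap n r s l g0" and av: "avoids n ?H l g0"
        using gap0 av0 gap_mod_cong[OF l(3)] avoids_mod_cong[OF l(3)] by blast+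
      have "\<not> (l < v \<and> v < l + g0)" if "v mod n \<in> ?H" for v
        using av that unfolding avoids_def by blast
      from this[of j'] this[of j] this[of "i + n"]
      have av: "\<not> (l < j' \<and> j' < l + g0)" "\<not> (l < j \<and> j < l + g0)" "\<not> (l < i + n \<and> i + n < l + g0)"
        by simp_all
      have left: "l = i \<and> g0 = g" if "l + g0 \<le> j"
        using ig gl l(1) that unfolding minimal_gap_def j_def by blast
      have right: "l = j' \<and> g0 = g'" if "j' \<le> l" "l + g0 \<le> i + n"
        using jm gl that unfolding minimal_gap_def jg by blast
      have "l + g0 \<le> i + n" using av(3) l(2) by linarith
      \<comment> \<open>The three vertices cut the rim into arcs, each properly inside one of the
        two minimal windows.\<close>
      consider "l < j'" | "j' \<le> l" "l < j" | "j \<le> l" by linarith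
      then show False
      proof cases
        case 1
        then have "l + g0 \<le> j'" using av(1) by linarith
        then show ?thesis using left ord by (simp add: j_def)
      next
        case 2
        then have "l + g0 \<le> j" using av(2) by linarith
        then show ?thesis using left 2 ord by simp
      next
        case 3
        then show ?thesis using right[OF _ \<open>l + g0 \<le> i + n\<close>] ord by simp
      qed
    qed
    ultimately show ?thesis by blast
  qed
qed

text \<open>If \<open>n < 2 * k\<close> and at most \<open>n\<close> colours occur,
  \<open>k - 1\<close> rim vertices hit all windows, and the hub as last vertex excludes the
  rim.\<close>

lemma few_vertices_lower_bound:
  assumes cov: "all_covered k" and k: "4 \<le> k" "k \<le> n"
  shows "(if n < 2 * k then n + 1 else n) \<le> card colours"
proof (cases "card colours \<le> n")
  case True
  have inj: "inj_on r {..<n}" by (rule rainbow_rim_or_many[OF cov k True])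
  have "\<not> n < 2 * k"
  proof
    assume "n < 2 * k"
    then have "3 \<le> k - 1" "n \<le> 2 * (k - 1) + 1" using k by linarith+
    then obtain H where H: "H \<subseteq> {..<n}" "card H \<le> k - 1"
      "\<forall>l g. gap n r s l g \<longrightarrow> \<not> avoids n H l g"
      using gap_hitting_set[OF inj True, of "k - 1"] by blast
    obtain T where T: "H \<subseteq> T" "T \<subseteq> {..<n}" "card T = k - 1"
    proof -
      have "k - 1 \<le> card {..<n}" using k by simp
      then show ?thesis using exists_subset_between[of H "k - 1" "{..<n}"] H that by blast
    qed
    have fin: "finite T" using T(2) by (rule finite_subset) simp
    have "n \<notin> T" using T(2) by auto
    then have card_T: "card (insert n T) = k" using T(3) fin k by simp
    have "covered n r s (insert n T)"
      by (rule all_coveredD[OF cov _ card_T]) (use T(2) in auto)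
    then obtain l g where "gap n r s l g" "avoids n (insert n T) l g"
      unfolding covered_def by auto
    moreover from this have "avoids n H l g" using T(1) unfolding avoids_def by blast
    ultimately show False using H(3) by blast
  qed
  then show ?thesis using inj_rim_card[OF inj] by simp
qed auto

end

section \<open>The rainbow cycle index of wheels\<close>

text \<open>\<open>C\<close> need only contain the colours used: the lower bound applies to the
  exhibited colouring too, so this uses exactly \<open>m\<close> of them.\<close>

lemma crx_wheel_eqI:
  assumes n: "n \<ge> 3"
    and upper: "\<And>S. S \<subseteq> {0..n} \<Longrightarrow> card S = k \<Longrightarrow> covered n (\<lambda>i. r (i mod n)) (\<lambda>i. s (i mod n)) S"
    and C: "finite C" "card C = m" "r ` {..<n} \<subseteq> C" "s ` {..<n} \<subseteq> C"
    and lower: "\<And>r s. periodic_colouring n r s \<Longrightarrow> periodic_colouring.all_covered n r s k \<Longrightarrow>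
      m \<le> card (periodic_colouring.colours n r s)"
  shows "crx (wheel_V n) (wheel_E n) k = m"
proof -
  have low: "m \<le> card (c ` wheel_E n)"
    if "k_rainbow_cycle_colouring (wheel_V n) (wheel_E n) k c" for c
  proof -
    interpret periodic_colouring n "rim_colour c n" "spoke_colour c n"
      by unfold_locales (use n in \<open>simp_all add: rim_colour_def spoke_colour_def flip: add_Suc\<close>)
    have "all_covered k" using that k_rainbow_iff_covered[OF n] unfolding all_covered_def by blast
    then have "m \<le> card colours" by (rule lower[OF periodic_colouring_axioms])
    then show ?thesis by (simp add: wheel_colours colours_def)
  qed
  obtain c where c: "rim_colour c n = (\<lambda>i. r (i mod n))" "spoke_colour c n = (\<lambda>i. s (i mod n))"
    using ex_colouring[OF n] .
  have good: "k_rainbow_cycle_colouring (wheel_V n) (wheel_E n) k c"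
    using k_rainbow_iff_covered[OF n] upper c by simp
  have "c ` wheel_E n \<subseteq> C"
    unfolding wheel_colours c using C(3,4) by auto
  then have "card (c ` wheel_E n) \<le> m"
    using card_mono[OF C(1)] C(2) by blast
  then have "card (c ` wheel_E n) = m" using low[OF good] by simp
  then show ?thesis
    unfolding crx_def using good low by (intro Least_equality) auto
qed

lemma crx_1_wheel:
  assumes n: "n \<ge> 3"
  shows "crx (wheel_V n) (wheel_E n) 1 = 3"
proof (rule crx_wheel_eqI[OF n])
  fix S assume "S \<subseteq> {0..n}" "card S = 1"
  then show "covered n (\<lambda>i. (\<lambda>_. 2) (i mod n)) (\<lambda>i. (\<lambda>j. j mod 2) (i mod n)) S"
    using covered_two_colour_spokes[OF n] by blast
next
  fix r s assume "periodic_colouring n r s" and cov: "periodic_colouring.all_covered n r s 1"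
  then interpret periodic_colouring n r s by simp
  have "covered n r s {0}" by (rule all_coveredD[OF cov]) auto
  then show "3 \<le> card colours" by (rule covered_card)
next
  show "card {0, 1, 2::nat} = 3" by simp
qed auto

lemma crx_K4:
  assumes k: "1 \<le> k" "k \<le> 3"
  shows "crx (wheel_V 3) (wheel_E 3) k = 3"
proof (rule crx_wheel_eqI)
  fix S :: "nat set" assume "S \<subseteq> {0..3}" "card S = k"
  then show "covered 3 (\<lambda>i. (\<lambda>j. j) (i mod 3)) (\<lambda>i. (\<lambda>j. (j + 1) mod 3) (i mod 3)) S"
    using covered_K4 k by auto
next
  fix r s assume "periodic_colouring 3 r s" and cov: "periodic_colouring.all_covered 3 r s k"
  then interpret periodic_colouring 3 r s by simp
  have "covered 3 r s {..<k}" by (rule all_coveredD[OF cov]) (use k in auto)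
  then show "3 \<le> card colours" by (rule covered_card)
next
  show "card {..<3::nat} = 3" by simp
qed auto

lemma crx_2_wheel:
  assumes n: "n \<ge> 4"
  shows "crx (wheel_V n) (wheel_E n) 2 = (n + 1) div 2 + 2"
proof (rule crx_wheel_eqI)
  fix S assume "S \<subseteq> {0..n}" "card S = 2"
  then show "covered n (\<lambda>i. (\<lambda>j. j mod ((n + 1) div 2)) (i mod n))
      (\<lambda>i. (\<lambda>j. if j < (n + 1) div 2 then (n + 1) div 2 else (n + 1) div 2 + 1) (i mod n)) S"
    using covered_half_period[OF n refl] by blast
next
  fix r s assume "periodic_colouring n r s" and cov: "periodic_colouring.all_covered n r s 2"
  then interpret periodic_colouring n r s by simp
  show "(n + 1) div 2 + 2 \<le> card colours" by (rule pairs_lower_bound[OF cov assms])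
next
  show "card {..<(n + 1) div 2 + 2} = (n + 1) div 2 + 2" by simp
  have "(n + 1) div 2 > 0" using n by simp
  then have "j mod ((n + 1) div 2) < (n + 1) div 2" for j by (rule mod_less_divisor)
  then show "(\<lambda>j. j mod ((n + 1) div 2)) ` {..<n} \<subseteq> {..<(n + 1) div 2 + 2}"
    by (auto intro: less_trans trans_less_add1)
qed (use n in auto)

text \<open>For \<open>q = 1, 2, 3\<close> the \<open>q - 1\<close> freed colours leave
  \<open>3 - q\<close> new ones for the spokes, so \<open>M = n + 3 - q\<close>; the colours
  \<open>2 * q\<close> and \<open>3 * q\<close> are saved.\<close>

lemma crx_3_wheel_aux:
  assumes n: "n \<ge> 4" and q: "0 < q" "4 * q \<le> n"
    and M: "M = (if n < 8 then n + 2 else if n < 12 then n + 1 else n)"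
    and cov: "\<And>S. finite S \<Longrightarrow> card (S - {n}) < 4 \<Longrightarrow>
      covered n (\<lambda>i. crossing_rim q (i mod n)) (\<lambda>i. s (i mod n)) S"
    and s: "s ` {..<n} \<subseteq> {..<M} - {2 * q, 3 * q}"
  shows "crx (wheel_V n) (wheel_E n) 3 = M - 2"
proof (rule crx_wheel_eqI)
  fix S assume S: "S \<subseteq> {0..n}" "card S = 3"
  have "finite S" using S(1) by (rule finite_subset) simp
  moreover from this have "card (S - {n}) < 4"
    using S(2) card_mono[of S "S - {n}"] by auto
  ultimately show "covered n (\<lambda>i. crossing_rim q (i mod n)) (\<lambda>i. s (i mod n)) S"
    by (rule cov)
next
  fix r s assume "periodic_colouring n r s" and cov: "periodic_colouring.all_covered n r s 3"
  then interpret periodic_colouring n r s by simp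
  show "M - 2 \<le> card colours" using triples_lower_bound[OF cov] M by auto
next
  show "card ({..<M} - {2 * q, 3 * q}) = M - 2" by (rule card_crossing_rim_colours) (use q M in \<open>auto split: if_splits\<close>)
  show "crossing_rim q ` {..<n} \<subseteq> {..<M} - {2 * q, 3 * q}"
  proof -
    have "n \<le> M" using M by simp
    then have "{..<n} - {2 * q, 3 * q} \<subseteq> {..<M} - {2 * q, 3 * q}" by auto
    then show ?thesis using crossing_rim_range[of q n] q by auto
  qed
qed (use n s in auto)

lemma crx_3_wheel:
  shows "4 \<le> n \<Longrightarrow> n \<le> 7 \<Longrightarrow> crx (wheel_V n) (wheel_E n) 3 = n"
    and "8 \<le> n \<Longrightarrow> n \<le> 11 \<Longrightarrow> crx (wheel_V n) (wheel_E n) 3 = n - 1"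
    and "12 \<le> n \<Longrightarrow> crx (wheel_V n) (wheel_E n) 3 = n - 2"
proof -
  assume n: "4 \<le> n" "n \<le> 7"
  show "crx (wheel_V n) (wheel_E n) 3 = n"
    using crx_3_wheel_aux[of n 1 "n + 2" "spokes_1 n"] n covered_spokes_1[OF n(1)] spokes_1_range[OF n(1)]
    by auto
next
  assume n: "8 \<le> n" "n \<le> 11"
  show "crx (wheel_V n) (wheel_E n) 3 = n - 1"
    using crx_3_wheel_aux[of n 2 "n + 1" "spokes_2 n"] n covered_spokes_2[OF n(1)] spokes_2_range[OF n(1)]
    by auto
next
  assume n: "12 \<le> n"
  show "crx (wheel_V n) (wheel_E n) 3 = n - 2"
    using crx_3_wheel_aux[of n 3 n spokes_3] n covered_spokes_3[OF n] spokes_3_range[OF n]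
    by auto
qed

lemma crx_ge_4_wheel:
  assumes k: "4 \<le> k" "k \<le> n + 1" and n: "3 \<le> n"
  shows "crx (wheel_V n) (wheel_E n) k = (if n < 2 * k then n + 1 else n)"
proof -
  have low: "(if n < 2 * k then n + 1 else n) \<le> card (periodic_colouring.colours n r s)"
    if "periodic_colouring n r s" and cov: "periodic_colouring.all_covered n r s k" for r s
  proof -
    interpret periodic_colouring n r s by (rule that(1))
    show ?thesis
    \<comment> \<open>The bound for smaller \<open>k\<close> uses sets of \<open>k\<close> rim
      vertices, which do not exist for \<open>k = n + 1\<close>.\<close>
    proof (cases "k = n + 1")
      case True
      then show ?thesis using all_vertices_lower_bound cov by simp
    next
      case False
      then show ?thesis using few_vertices_lower_bound[OF cov k(1)] k(2) by simp
    qed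
  qed
  show ?thesis
  proof (cases "n < 2 * k")
    case True
    have "crx (wheel_V n) (wheel_E n) k = n + 1"
    proof (rule crx_wheel_eqI[OF n covered_hamiltonian[OF n]])
      show "card {..<n + 1} = n + 1" by simp
    qed (use True low in \<open>auto simp: image_subset_iff\<close>)
    then show ?thesis using True by simp
  next
    case False
    have "crx (wheel_V n) (wheel_E n) k = n"
    proof (rule crx_wheel_eqI[OF n])
      fix S assume S: "S \<subseteq> {0..n}" "card S = k"
      then have "finite S" by (meson finite_atLeastAtMost finite_subset)
      then show "covered n (\<lambda>i. (\<lambda>j. j) (i mod n)) (\<lambda>i. (\<lambda>j. 2 * (j div 2)) (i mod n)) S"
        by (intro covered_rainbow_rim[where k = k]) (use S k n False in auto)
    next
      show "card {..<n} = n" by simp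
    qed (use False low in \<open>auto simp: image_subset_iff\<close>)
    then show ?thesis using False by simp
  qed
qed

theorem theorem3p1:
  shows "(\<forall>n\<ge>3. crx (wheel_V n) (wheel_E n) 1 = 3)
    \<and> crx (wheel_V 3) (wheel_E 3) 2 = 3
    \<and> (\<forall>n\<ge>4. crx (wheel_V n) (wheel_E n) 2 = nat \<lceil>real n / 2\<rceil> + 2)
    \<and> (\<forall>n. 3 \<le> n \<and> n \<le> 7 \<longrightarrow> crx (wheel_V n) (wheel_E n) 3 = n)
    \<and> (\<forall>n. 8 \<le> n \<and> n \<le> 11 \<longrightarrow> crx (wheel_V n) (wheel_E n) 3 = n - 1)
    \<and> (\<forall>n\<ge>12. crx (wheel_V n) (wheel_E n) 3 = n - 2)
    \<and> (\<forall>k n. 4 \<le> k \<and> 3 \<le> n \<and> k \<le> n + 1 \<longrightarrow>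
         crx (wheel_V n) (wheel_E n) k = (if n < 2 * k then n + 1 else n))"
proof (intro conjI allI impI)
  fix n :: nat assume n: "4 \<le> n"
  have "\<lceil>real n / 2\<rceil> = int ((n + 1) div 2)"
    by (cases "even n") (auto elim!: evenE oddE simp: ceiling_eq_iff)
  then show "crx (wheel_V n) (wheel_E n) 2 = nat \<lceil>real n / 2\<rceil> + 2"
    using crx_2_wheel[OF n] by simp
next
  fix n :: nat assume n: "3 \<le> n \<and> n \<le> 7"
  show "crx (wheel_V n) (wheel_E n) 3 = n"
  \<comment> \<open>The four windows used for larger wheels need \<open>n \<ge> 4\<close>.\<close>
  proof (cases "n = 3")
    case True
    then show ?thesis using crx_K4[of 3] by simp
  next
    case False
    then show ?thesis using crx_3_wheel(1) n by simp
  qed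
qed (use crx_1_wheel crx_K4[of 2] crx_3_wheel crx_ge_4_wheel in auto)

end
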